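(* Let $(a_i,b_i)$, $i=1,\dots,n$, be training examples with $a_i\in\mathbb{R}^d$, let $\lambda>0$, and assume the loss $\ell(z,b)$ is, as a function of $z\in\mathbb{R}$, nonnegative, convex, smooth (differentiable with Lipschitz continuous derivative) and piecewise quadratic. Let $F$ be either the objective $$F(x)=\frac1n\sum_{i=1}^n\ell(x^\top a_i,b_i)+\lambda R(x),\qquad x\in\mathbb{R}^d,$$ where $R$ is the $\ell_1$ norm, the $\ell_\infty$ norm or the Huber norm, or the objective $$F(x_1,\dots,x_M)=\frac1n\sum_{i=1}^n\sum_{m=1}^M\ell(x_m^\top a_i,b_{im})+\lambda\sum_{m=1}^M\|x_m\|_\infty,\qquad x_1,\dots,x_M\in\mathbb{R}^d$$ ($\ell_{1,\infty}$ norm regularization). Then for every $\xi>0$, $F$ satisfies the HEB condition with $\theta=1/2$ on the sublevel set $\mathcal{S}_\xi$. Hence adaAGC (run with $\theta=1/2$) has a global linear convergence in terms of the proximal gradient's norm with a square root dependence on the condition number: for any starting point $x_0$, if $c$ is an HEB constant on $\mathcal{S}_{\epsilon_0}$ with $\epsilon_0\ge F(x_0)-F_*$, $0<c_0\le c$, $\gamma>1$, $\varepsilon_0=\|G(x_0)\|_2$, $0<\epsilon\le\varepsilon_0$ and $K=\lceil\log_2(\varepsilon_0/\epsilon)\rceil$, it reaches $\|G(x_K)\|_2\le\epsilon$ in $\widetilde O\left(\sqrt{Lc^2}\,\max(1,\log(\varepsilon_0/\epsilon))\right)$ iterations, where $\widetilde O$ suppresses a log term depending on $c,c_0,L,\g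amma$.
   Context: Write $F=f+g$ with $f$ the average loss term (convex and $L$-smooth, i.e. with $L$-Lipschitz gradient, $L>0$) and $g$ the regularization term. The Huber norm is $R(x)=\sum_{i=1}^dh(x_i)$ with, for a fixed $\delta>0$, $h(x)=\delta(|x|-\delta/2)$ if $|x|\ge\delta$ and $h(x)=x^2/2$ otherwise. Piecewise quadratic means piecewise convex quadratic: a continuous function on $\mathbb{R}^m$ is a piecewise convex quadratic function if $\mathbb{R}^m$ is a union of finitely many polyhedra on each of which the function is a convex polynomial of degree at most $2$. $\Omega_*$ is the set of minimizers of $F$, $F_*$ the minimum value, $D(x,\Omega_* )=\min_{y\in\Omega_*}\|x-y\|_2$, $\mathcal{S}_\xi=\{x:F(x)-F_*\le\xi\}$. HEB condition with $\theta$ on $\mathcal{S}_\xi$: there is $0<c<\infty$ with $D(x,\Omega_* )\le c\,(F(x)-F_* )^\theta$ for all $x\in\mathcal{S}_\xi$. For $\theta=1/2$, $C=Lc^2$ is called the condition number. Proximal mapping: $P_{\eta h}(u)=\arg\min_{x}\frac12\|x-u\|_2^2+\eta h(x)$. Proximal gradient: $G(x)=L(x-x^+)$ with $x^+=P_{g/L}(x-\nabla f(x)/L)$. adaAGC with $\theta=1/2$: set $c_e=c_0$ and $\varepsilon_0=\|G(x_0)\|_2$. For stages $k=1,\dots,K$, perform cycles $s=1,2,\dots$ as follows. In each cycle let $\delta_k=\min\left(\frac{L}{32},\frac{1}{32c_e^2}\right)$ and $g_{\delta_k}(x)=g(x)+\frac{\delta_k}{2}\|x-x_{k-1}\|_2^2$;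 set $A_0=0$, $v_0=x^k_0=x_{k-1}$; for $t=0,1,2,\dots$: let $a_{t+1}>0$ be the root $a$ of $\frac{a^2}{A_t+a}=2\frac{1+\delta_kA_t}{L}$; set $A_{t+1}=A_t+a_{t+1}$, $y_t=\frac{A_t}{A_{t+1}}x^k_t+\frac{a_{t+1}}{A_{t+1}}v_t$, $x^k_{t+1}=P_{g_{\delta_k}/L}(y_t-\nabla f(y_t)/L)$, $v_{t+1}=\arg\min_x\frac12\|x-x_{k-1}\|_2^2+\sum_{\tau=1}^{t+1}a_\tau\nabla f(x^k_\tau)^\top x+A_{t+1}g_{\delta_k}(x)$. If $\|G(x^k_{t+1})\|_2\le\varepsilon_{k-1}/2$, set $x_k=x^k_{t+1}$, $\varepsilon_k=\varepsilon_{k-1}/2$ and go to stage $k+1$. Otherwise, if $t=\left\lceil\sqrt{\frac{2L}{\delta_k}}\log\frac{\sqrt{L(L+\delta_k)}}{\delta_k}\right\rceil$, replace $c_e$ by $\gamma c_e$ and start the next cycle of the same stage. The output is $x_K$. Iterations are counted over all cycles and stages.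
   Formalization: The iteration bound is proved with max(1, Lc²) in place of Lc², since the bound as stated fails when Lc² is very small (each stage takes at least one iteration); the O-constant is explicit and contains a linear factor γ, besides logarithmic terms in c/c_0 and γ²max(1, Lc²). *)

theory Defs
  imports "HOL-Analysis.Analysis"
begin

section \<open>Piecewise convex quadratic functions and smoothness\<close>

definition convex_quadratic :: "('a::euclidean_space \<Rightarrow> real) \<Rightarrow> bool" where
  "convex_quadratic q \<longleftrightarrow> convex_on UNIV q \<and>
     (\<exists>A b c. linear A \<and> (\<forall>x. q x = x \<bullet> A x + b \<bullet> x + c))"

definition piecewise_convex_quadratic :: "('a::euclidean_space \<Rightarrow> real) \<Rightarrow> bool" where
  "piecewise_convex_quadratic f \<longleftrightarrow> continuous_on UNIV f \<and>
     (\<exists>\<P>. finite \<P> \<and> \<Union>\<P> = UNIV \<and>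
        (\<forall>P\<in>\<P>. polyhedron P \<and> (\<exists>q. convex_quadratic q \<and> (\<forall>x\<in>P. f x = q x))))"

definition grad :: "('a::real_inner \<Rightarrow> real) \<Rightarrow> 'a \<Rightarrow> 'a" where
  "grad f x = (THE D. GDERIV f x :> D)"

definition L_smooth :: "real \<Rightarrow> ('a::real_inner \<Rightarrow> real) \<Rightarrow> bool" where
  "L_smooth L f \<longleftrightarrow> (\<forall>x. \<exists>D. GDERIV f x :> D) \<and> L-lipschitz_on UNIV (grad f)"

definition admissible_loss :: "(real \<Rightarrow> real) \<Rightarrow> bool" where
  "admissible_loss \<phi> \<longleftrightarrow> (\<forall>z. 0 \<le> \<phi> z) \<and> convex_on UNIV \<phi> \<and>
     (\<exists>C. L_smooth C \<phi>) \<and> piecewise_convex_quadratic \<phi>"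

section \<open>Objectives\<close>

definition l1_norm :: "real ^ 'd \<Rightarrow> real" where
  "l1_norm x = (\<Sum>i\<in>UNIV. \<bar>x $ i\<bar>)"

definition huber :: "real \<Rightarrow> real \<Rightarrow> real" where
  "huber \<delta> t = (if \<bar>t\<bar> \<ge> \<delta> then \<delta> * (\<bar>t\<bar> - \<delta> / 2) else t\<^sup>2 / 2)"

definition huber_norm :: "real \<Rightarrow> real ^ 'd \<Rightarrow> real" where
  "huber_norm \<delta> x = (\<Sum>i\<in>UNIV. huber \<delta> (x $ i))"

definition avg_loss :: "(real \<Rightarrow> 'b \<Rightarrow> real) \<Rightarrow> nat \<Rightarrow> (nat \<Rightarrow> real ^ 'd) \<Rightarrow> (nat \<Rightarrow> 'b)
    \<Rightarrow> real ^ 'd \<Rightarrow> real" where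
  "avg_loss l n a b x = (1 / real n) * (\<Sum>i=1..n. l (x \<bullet> a i) (b i))"

text \<open>A tuple of vectors is an element of \<open>real ^ 'd ^ 'm\<close>, whose norm is the Euclidean norm
  of the concatenation of its components.\<close>

definition avg_loss_multi ::
    "(real \<Rightarrow> 'b \<Rightarrow> real) \<Rightarrow> nat \<Rightarrow> (nat \<Rightarrow> real ^ 'd) \<Rightarrow> (nat \<Rightarrow> 'm \<Rightarrow> 'b)
      \<Rightarrow> real ^ 'd ^ 'm \<Rightarrow> real" where
  "avg_loss_multi l n a b x = (1 / real n) * (\<Sum>i=1..n. \<Sum>m\<in>UNIV. l (x $ m \<bullet> a i) (b i m))"

definition l1_inf_norm :: "real ^ 'd ^ 'm \<Rightarrow> real" where
  "l1_inf_norm x = (\<Sum>m\<in>UNIV. infnorm (x $ m))"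

section \<open>Hoelderian error bound\<close>

definition minimizers :: "('a \<Rightarrow> real) \<Rightarrow> 'a set" where
  "minimizers F = {x. \<forall>y. F x \<le> F y}"

definition min_value :: "('a \<Rightarrow> real) \<Rightarrow> real" where
  "min_value F = (INF x. F x)"

definition sublevel :: "('a \<Rightarrow> real) \<Rightarrow> real \<Rightarrow> 'a set" where
  "sublevel F \<xi> = {x. F x - min_value F \<le> \<xi>}"

text \<open>Nonemptiness of the set of minimizers is required explicitly: the infimum and \<open>infdist\<close> have
  dummy values without it.\<close>

definition HEB_constant :: "('a::euclidean_space \<Rightarrow> real) \<Rightarrow> real \<Rightarrow> 'a set \<Rightarrow> real \<Rightarrow> bool" where
  "HEB_constant F \<theta> S c \<longleftrightarrow> minimizers F \<noteq> {} \<and> 0 < c \<and>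
     (\<forall>x\<in>S. infdist x (minimizers F) \<le> c * (F x - min_value F) powr \<theta>)"

definition HEB :: "('a::euclidean_space \<Rightarrow> real) \<Rightarrow> real \<Rightarrow> 'a set \<Rightarrow> bool" where
  "HEB F \<theta> S \<longleftrightarrow> (\<exists>c. HEB_constant F \<theta> S c)"

section \<open>The algorithm adaAGC for exponent 1/2\<close>

definition prox :: "real \<Rightarrow> ('a::euclidean_space \<Rightarrow> real) \<Rightarrow> 'a \<Rightarrow> 'a" where
  "prox \<eta> h u = (ARG_MIN (\<lambda>x. (norm (x - u))\<^sup>2 / 2 + \<eta> * h x) x. True)"

definition prox_grad_step ::
    "('a::euclidean_space \<Rightarrow> real) \<Rightarrow> ('a \<Rightarrow> real) \<Rightarrow> real \<Rightarrow> 'a \<Rightarrow> 'a" where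
  "prox_grad_step f g L x = prox (1 / L) g (x - (1 / L) *\<^sub>R grad f x)"

definition prox_gradient ::
    "('a::euclidean_space \<Rightarrow> real) \<Rightarrow> ('a \<Rightarrow> real) \<Rightarrow> real \<Rightarrow> 'a \<Rightarrow> 'a" where
  "prox_gradient f g L x = L *\<^sub>R (x - prox_grad_step f g L x)"

definition regularize :: "('a::euclidean_space \<Rightarrow> real) \<Rightarrow> real \<Rightarrow> 'a \<Rightarrow> 'a \<Rightarrow> real" where
  "regularize g \<delta> x0 x = g x + \<delta> / 2 * (norm (x - x0))\<^sup>2"

definition reg_param :: "real \<Rightarrow> real \<Rightarrow> real" where
  "reg_param L ce = min (L / 32) (1 / (32 * ce\<^sup>2))"

definition next_coeff :: "real \<Rightarrow> real \<Rightarrow> real \<Rightarrow> real" where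
  "next_coeff L \<delta> A = (THE a. 0 < a \<and> a\<^sup>2 / (A + a) = 2 * ((1 + \<delta> * A) / L))"

text \<open>The state after \<open>t\<close> iterations of a cycle started at \<open>x0\<close> is \<open>(A\<^sub>t, x\<^sub>t, v\<^sub>t, z\<^sub>t)\<close>, where
  \<open>z\<^sub>t\<close> accumulates the sum of \<open>a\<^sub>\<tau> *\<^sub>R grad f x\<^sub>\<tau>\<close> over \<open>1 \<le> \<tau> \<le> t\<close>.\<close>

primrec agc_state :: "('a::euclidean_space \<Rightarrow> real) \<Rightarrow> ('a \<Rightarrow> real) \<Rightarrow> real \<Rightarrow> real \<Rightarrow> 'a
    \<Rightarrow> nat \<Rightarrow> real \<times> 'a \<times> 'a \<times> 'a" where
  "agc_state f g L \<delta> x0 0 = (0, x0, x0, 0)"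
| "agc_state f g L \<delta> x0 (Suc t) =
    (let (A, x, v, z) = agc_state f g L \<delta> x0 t;
         a = next_coeff L \<delta> A;
         A' = A + a;
         y = (A / A') *\<^sub>R x + (a / A') *\<^sub>R v;
         x' = prox_grad_step f (regularize g \<delta> x0) L y;
         z' = z + a *\<^sub>R grad f x';
         v' = (ARG_MIN (\<lambda>w. (norm (w - x0))\<^sup>2 / 2 + z' \<bullet> w + A' * regularize g \<delta> x0 w) w. True)
     in (A', x', v', z'))"

definition agc_iterate :: "('a::euclidean_space \<Rightarrow> real) \<Rightarrow> ('a \<Rightarrow> real) \<Rightarrow> real \<Rightarrow> real \<Rightarrow> 'a
    \<Rightarrow> nat \<Rightarrow> 'a" where
  "agc_iterate f g L \<delta> x0 t = fst (snd (agc_state f g L \<delta> x0 t))"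

definition last_index :: "real \<Rightarrow> real \<Rightarrow> nat" where
  "last_index L \<delta> = nat \<lceil>sqrt (2 * L / \<delta>) * ln (sqrt (L * (L + \<delta>)) / \<delta>)\<rceil>"

text \<open>\<open>stage f g L \<gamma> x \<epsilon> ce N x' ce'\<close>: the stage started at \<open>x\<close> with current accuracy \<open>\<epsilon>\<close> and
  estimate \<open>ce\<close> ends at \<open>x'\<close> with estimate \<open>ce'\<close>, after \<open>N\<close> iterations over all its cycles.
  Every cycle of the stage starts at \<open>x\<close> again. A cycle that fails has tested the iterates
  with index \<open>1, \<dots>, last_index + 1\<close>.\<close>

inductive stage :: "('a::euclidean_space \<Rightarrow> real) \<Rightarrow> ('a \<Rightarrow> real) \<Rightarrow> real \<Rightarrow> real
    \<Rightarrow> 'a \<Rightarrow> real \<Rightarrow> real \<Rightarrow> nat \<Rightarrow> 'a \<Rightarrow> real \<Rightarrow> bool"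
  for f :: "'a::euclidean_space \<Rightarrow> real" and g :: "'a \<Rightarrow> real" and L \<gamma> :: real
    and x :: 'a and \<epsilon> :: real where
  success: "t \<le> last_index L \<delta> \<Longrightarrow>
      norm (prox_gradient f g L (agc_iterate f g L \<delta> x (Suc t))) \<le> \<epsilon> / 2 \<Longrightarrow>
      (\<And>s. s < t \<Longrightarrow> \<not> norm (prox_gradient f g L (agc_iterate f g L \<delta> x (Suc s))) \<le> \<epsilon> / 2) \<Longrightarrow>
      stage f g L \<gamma> x \<epsilon> ce (Suc t) (agc_iterate f g L \<delta> x (Suc t)) ce"
    if "\<delta> = reg_param L ce"
| failure: "(\<And>s. s \<le> last_index L \<delta> \<Longrightarrow>
        \<not> norm (prox_gradient f g L (agc_iterate f g L \<delta> x (Suc s))) \<le> \<epsilon> / 2) \<Longrightarrow>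
      stage f g L \<gamma> x \<epsilon> (\<gamma> * ce) N x' ce' \<Longrightarrow>
      stage f g L \<gamma> x \<epsilon> ce (Suc (last_index L \<delta>) + N) x' ce'"
    if "\<delta> = reg_param L ce"

text \<open>\<open>adaAGC f g L \<gamma> c0 x0 k N x \<epsilon> ce\<close>: the first \<open>k\<close> stages terminate, after \<open>N\<close> iterations in
  total, at \<open>x\<close> with accuracy \<open>\<epsilon>\<close> and estimate \<open>ce\<close>.\<close>

inductive adaAGC :: "('a::euclidean_space \<Rightarrow> real) \<Rightarrow> ('a \<Rightarrow> real) \<Rightarrow> real \<Rightarrow> real \<Rightarrow> real \<Rightarrow> 'a
    \<Rightarrow> nat \<Rightarrow> nat \<Rightarrow> 'a \<Rightarrow> real \<Rightarrow> real \<Rightarrow> bool"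
  for f :: "'a::euclidean_space \<Rightarrow> real" and g :: "'a \<Rightarrow> real" and L \<gamma> c0 :: real
    and x0 :: 'a where
  start: "adaAGC f g L \<gamma> c0 x0 0 0 x0 (norm (prox_gradient f g L x0)) c0"
| step: "adaAGC f g L \<gamma> c0 x0 k N x \<epsilon> ce \<Longrightarrow> stage f g L \<gamma> x \<epsilon> ce N' x' ce' \<Longrightarrow>
      adaAGC f g L \<gamma> c0 x0 (Suc k) (N + N') x' (\<epsilon> / 2) ce'"

section \<open>The complexity claim\<close>

text \<open>\<open>r\<close> is the ratio of initial to target accuracy. The two middle factors form the suppressed
  logarithmic term; \<open>128 * \<gamma>\<close> is the constant of the O-notation, given explicitly because an
  existentially quantified one could depend on the dimension through the type. The factor \<open>\<gamma>\<close>
  accounts for the estimate \<open>ce\<close> overshooting \<open>c\<close> by at most that factor. The condition number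
  \<open>L * c\<^sup>2\<close> is replaced by 1 when it is smaller than 1, since every stage takes at least one
  iteration while \<open>L * c\<^sup>2\<close> can be arbitrarily small.\<close>

definition iteration_bound :: "real \<Rightarrow> real \<Rightarrow> real \<Rightarrow> real \<Rightarrow> real \<Rightarrow> real" where
  "iteration_bound L c c0 \<gamma> r =
     (let \<kappa> = max 1 (L * c\<^sup>2) in
       128 * \<gamma> * (1 + log \<gamma> (c / c0)) * (1 + ln (\<gamma>\<^sup>2 * \<kappa>)) * (sqrt \<kappa> * max 1 (ln r)))"

definition adaAGC_linear_convergence ::
    "('a::euclidean_space \<Rightarrow> real) \<Rightarrow> ('a \<Rightarrow> real) \<Rightarrow> bool" where
  "adaAGC_linear_convergence f g \<longleftrightarrow>
    (\<forall>L x0 \<epsilon>0 c c0 \<gamma> \<epsilon>.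
      let F = (\<lambda>x. f x + g x); G = prox_gradient f g L; K = nat \<lceil>log 2 (norm (G x0) / \<epsilon>)\<rceil> in
      0 < L \<and> L_smooth L f \<and> F x0 - min_value F \<le> \<epsilon>0 \<and> HEB_constant F (1/2) (sublevel F \<epsilon>0) c \<and>
      0 < c0 \<and> c0 \<le> c \<and> 1 < \<gamma> \<and> 0 < \<epsilon> \<and> \<epsilon> \<le> norm (G x0) \<longrightarrow>
      (\<exists>N x e ce. adaAGC f g L \<gamma> c0 x0 K N x e ce) \<and>
      (\<forall>N x e ce. adaAGC f g L \<gamma> c0 x0 K N x e ce \<longrightarrow>
         norm (G x) \<le> \<epsilon> \<and> real N \<le> iteration_bound L c c0 \<gamma> (norm (G x0) / \<epsilon>)))"

end

theory Submission
  imports Defs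
begin

text \<open>
  The theorem combines two independent facts: the error bound with exponent 1/2 is a polyhedral
  property of the objectives, and the complexity of adaAGC holds for any smooth convex \<open>f\<close> and
  convex \<open>g\<close> for which an error bound constant is given.

  \<^emph>\<open>Error bound.\<close> Losses and regularizers are piecewise convex quadratic, and this property is closed
  under sums, nonnegative multiples and composition with linear functionals. The regularizers grow
  linearly, so sublevel sets are bounded and finitely many polytopes with a convex quadratic on each
  cover them. On a polytope \<open>P\<close> a convex quadratic \<open>q\<close> has its minimizers described by linear equations
  within \<open>P\<close>, whose residuals are bounded by the square root of the excess of \<open>q\<close>. What remains is a
  Hoffman bound, the distance to the solutions in terms of the residuals. As \<open>P\<close> is the convex
  hull of finitely many points, it follows by shifting weights between vertices
  (\<open>polytope_face_error_bound\<close>). The result is \<open>piecewise_convex_quadratic_HEB\<close>.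

  \<^emph>\<open>Complexity.\<close> A cycle minimizes \<open>f + g\<close> plus a \<open>\<delta>\<close>-strongly convex term centred at its starting
  point. Nesterov's estimate sequence (\<open>agc_invariant\<close>) shows that the gap of this regularized
  objective is at most \<open>D\<^sup>2 / (2 * A)\<close>, where \<open>D\<close> is the distance of the starting point to the
  minimizers of \<open>f + g\<close> and the weight \<open>A\<close> grows geometrically with ratio about
  \<open>1 + sqrt (2 * \<delta> / L)\<close>. After the prescribed number of steps the proximal gradient is at most
  \<open>4 * \<delta> * D\<close>. The error bound gives \<open>D \<le> (2 / L + c\<^sup>2) * norm (G x)\<close> for the starting point \<open>x\<close>, so
  that once the estimate \<open>ce\<close> has reached \<open>c\<close> the choice of \<open>\<delta>\<close> makes the cycle halve the proximal
  gradient (\<open>cycle_halves_prox_gradient\<close>). Hence cycles fail only while \<open>ce < c\<close>. This limits their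
  number to \<open>1 + log \<gamma> (c / c0)\<close> and the estimate to \<open>\<gamma> * c\<close>, and the bound on the iterations follows by
  multiplying the number of cycles by the greatest length of one.
\<close>

section \<open>Error bounds on polytopes\<close>

text \<open>A point of a polytope is a convex combination of vertices. Shifting the weight of the vertices
  off the face \<open>a \<bullet> (y - x0) = 0\<close> to one vertex on it lands in the face. The shift moves the point
  at most in proportion to that weight, and each unit of that weight contributes at least the least
  positive vertex value to \<open>a \<bullet> (x - x0)\<close>.\<close>

lemma polytope_face_error_bound:
  fixes P :: "'a::euclidean_space set"
  assumes "polytope P" and x0: "x0 \<in> P" and nonneg: "\<And>x. x \<in> P \<Longrightarrow> 0 \<le> a \<bullet> (x - x0)"
  shows "\<exists>\<kappa>\<ge>0. \<forall>x\<in>P. \<exists>y\<in>P. a \<bullet> (y - x0) = 0 \<and> norm (x - y) \<le> \<kappa> * (a \<bullet> (x - x0))"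
proof -
  obtain V where V: "finite V" "P = convex hull V" using assms(1) by (auto simp: polytope_def)
  define \<phi> where "\<phi> = (\<lambda>x. a \<bullet> (x - x0))"
  define V0 V1 where "V0 = {v \<in> V. \<phi> v = 0}" and "V1 = {v \<in> V. \<phi> v \<noteq> 0}"
  have VP: "v \<in> P" if "v \<in> V" for v using that V hull_subset[of V convex] by auto
  have fin: "finite V0" "finite V1" "V = V0 \<union> V1" "V0 \<inter> V1 = {}"
    using V by (auto simp: V0_def V1_def)
  have pos: "0 < \<phi> v" if "v \<in> V1" for v
    using nonneg[OF VP] that by (force simp: V1_def \<phi>_def)
  have combination: "\<exists>u. (\<forall>v\<in>V. 0 \<le> u v) \<and> sum u V = 1 \<and> (\<Sum>v\<in>V. u v *\<^sub>R v) = x" if "x \<in> P" for x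
    using that unfolding V(2) convex_hull_finite[OF V(1)] by auto
  have \<phi>_comb: "\<phi> (\<Sum>v\<in>V. u v *\<^sub>R v) = (\<Sum>v\<in>V1. u v * \<phi> v)" if "sum u V = 1" for u
  proof -
    have "\<phi> (\<Sum>v\<in>V. u v *\<^sub>R v) = (\<Sum>v\<in>V. u v * (a \<bullet> v)) - sum u V * (a \<bullet> x0)"
      by (simp add: \<phi>_def inner_diff_right inner_sum_right that)
    also have "\<dots> = (\<Sum>v\<in>V. u v * \<phi> v)"
      by (simp add: \<phi>_def inner_diff_right sum_distrib_right sum_subtractf right_diff_distrib)
    also have "\<dots> = (\<Sum>v\<in>V1. u v * \<phi> v)"
      using V(1) by (intro sum.mono_neutral_right) (auto simp: V1_def)
    finally show ?thesis .
  qed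
  have "V0 \<noteq> {}"
  proof
    assume "V0 = {}"
    then have "V = V1" using fin by simp
    obtain u where u: "\<forall>v\<in>V. 0 \<le> u v" "sum u V = 1" "(\<Sum>v\<in>V. u v *\<^sub>R v) = x0"
      using combination[OF x0] by blast
    have "(\<Sum>v\<in>V. u v * \<phi> v) = 0"
      using \<phi>_comb[OF u(2)] u(3) \<open>V = V1\<close> by (simp add: \<phi>_def)
    then have "\<forall>v\<in>V. u v * \<phi> v = 0"
      using u(1) pos \<open>V = V1\<close> V(1)
      by (subst (asm) sum_nonneg_eq_0_iff) (auto intro!: mult_nonneg_nonneg[OF _ less_imp_le])
    then have "\<forall>v\<in>V. u v = 0" using pos \<open>V = V1\<close> by force
    then show False using u(2) by simp
  qed
  then obtain v0 where v0: "v0 \<in> V0" by blast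
  define \<kappa> where "\<kappa> = (\<Sum>v\<in>V1. norm (v - v0) / \<phi> v)"
  have \<kappa>0: "0 \<le> \<kappa>" unfolding \<kappa>_def using pos by (intro sum_nonneg divide_nonneg_pos) auto
  have \<kappa>: "norm (v - v0) \<le> \<kappa> * \<phi> v" if "v \<in> V1" for v
  proof -
    have "norm (v - v0) / \<phi> v \<le> \<kappa>"
      unfolding \<kappa>_def using pos fin that by (intro member_le_sum divide_nonneg_pos) auto
    then show ?thesis using pos[OF that] by (simp add: divide_le_eq)
  qed
  have "\<exists>y\<in>P. \<phi> y = 0 \<and> norm (x - y) \<le> \<kappa> * \<phi> x" if x: "x \<in> P" for x
  proof -
    obtain u where u: "\<forall>v\<in>V. 0 \<le> u v" "sum u V = 1" "(\<Sum>v\<in>V. u v *\<^sub>R v) = x"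
      using combination[OF x] by blast
    have split: "(\<Sum>v\<in>V. h v) = (\<Sum>v\<in>V0. h v) + (\<Sum>v\<in>V1. h v)" for h :: "'a \<Rightarrow> 'b::comm_monoid_add"
      using fin by (simp add: sum.union_disjoint)
    define y where "y = (\<Sum>v\<in>V0. u v *\<^sub>R v) + (\<Sum>v\<in>V1. u v *\<^sub>R v0)"
    have xy: "x - y = (\<Sum>v\<in>V1. u v *\<^sub>R (v - v0))"
      unfolding u(3)[symmetric] split y_def by (simp add: sum_subtractf scaleR_diff_right)
    have ysum: "y = (\<Sum>v\<in>V. u v *\<^sub>R (if v \<in> V0 then v else v0))"
      unfolding split y_def using fin by (intro arg_cong2[of _ _ _ _ "(+)"] sum.cong) auto
    have "convex P" using V by simp
    then have "y \<in> P" unfolding ysum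
      using u v0 VP V(1) by (intro convex_sum) (auto simp: V0_def)
    moreover have "\<phi> y = 0"
    proof -
      have "\<phi> y = \<phi> x - a \<bullet> (x - y)" by (simp add: \<phi>_def inner_diff_right)
      also have "\<phi> x = (\<Sum>v\<in>V1. u v * \<phi> v)" using \<phi>_comb[OF u(2)] u(3) by simp
      also have "a \<bullet> (x - y) = (\<Sum>v\<in>V1. u v * \<phi> v)"
        unfolding xy using v0 by (simp add: inner_sum_right V0_def \<phi>_def inner_diff_right)
      finally show ?thesis by simp
    qed
    moreover have "norm (x - y) \<le> \<kappa> * \<phi> x"
    proof -
      have "norm (x - y) \<le> (\<Sum>v\<in>V1. norm (u v *\<^sub>R (v - v0)))" unfolding xy by (rule norm_sum)
      also have "\<dots> \<le> (\<Sum>v\<in>V1. u v * (\<kappa> * \<phi> v))"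
        using u(1) \<kappa> fin by (intro sum_mono) (auto intro!: mult_left_mono)
      also have "\<dots> = \<kappa> * \<phi> x"
        using \<phi>_comb[OF u(2)] u(3) by (simp add: sum_distrib_left mult_ac)
      finally show ?thesis .
    qed
    ultimately show ?thesis by blast
  qed
  then show ?thesis using \<kappa>0 unfolding \<phi>_def by blast
qed

text \<open>Each of the two halves into which the hyperplane cuts \<open>P\<close> is a polytope that has the intersection
  as a face.\<close>

lemma polytope_hyperplane_error_bound:
  fixes P :: "'a::euclidean_space set"
  assumes P: "polytope P" and x0: "x0 \<in> P"
  shows "\<exists>\<kappa>\<ge>0. \<forall>x\<in>P. \<exists>y\<in>P. a \<bullet> (y - x0) = 0 \<and> norm (x - y) \<le> \<kappa> * \<bar>a \<bullet> (x - x0)\<bar>"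
proof -
  have half: "\<exists>\<kappa>\<ge>0. \<forall>x\<in>P. 0 \<le> b \<bullet> (x - x0) \<longrightarrow>
      (\<exists>y\<in>P. b \<bullet> (y - x0) = 0 \<and> norm (x - y) \<le> \<kappa> * (b \<bullet> (x - x0)))" for b
  proof -
    let ?Q = "P \<inter> {x. b \<bullet> x \<ge> b \<bullet> x0}"
    have "polytope ?Q" using P by (intro polytope_Int_polyhedron polyhedron_halfspace_ge)
    moreover have "x0 \<in> ?Q" using x0 by simp
    moreover have "0 \<le> b \<bullet> (x - x0)" if "x \<in> ?Q" for x using that by (simp add: inner_diff_right)
    ultimately have "\<exists>\<kappa>\<ge>0. \<forall>x\<in>?Q. \<exists>y\<in>?Q. b \<bullet> (y - x0) = 0 \<and> norm (x - y) \<le> \<kappa> * (b \<bullet> (x - x0))"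
      by (rule polytope_face_error_bound)
    then obtain \<kappa> where \<kappa>: "0 \<le> \<kappa>" "\<And>x. x \<in> ?Q \<Longrightarrow>
        \<exists>y\<in>?Q. b \<bullet> (y - x0) = 0 \<and> norm (x - y) \<le> \<kappa> * (b \<bullet> (x - x0))" by blast
    have "\<exists>y\<in>P. b \<bullet> (y - x0) = 0 \<and> norm (x - y) \<le> \<kappa> * (b \<bullet> (x - x0))"
      if "x \<in> P" "0 \<le> b \<bullet> (x - x0)" for x
      using \<kappa>(2)[of x] that by (auto simp: inner_diff_right)
    then show ?thesis using \<kappa>(1) by blast
  qed
  obtain \<kappa>1 where \<kappa>1: "0 \<le> \<kappa>1" "\<And>x. x \<in> P \<Longrightarrow> 0 \<le> a \<bullet> (x - x0) \<Longrightarrow>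
      \<exists>y\<in>P. a \<bullet> (y - x0) = 0 \<and> norm (x - y) \<le> \<kappa>1 * (a \<bullet> (x - x0))"
    using half[of a] by blast
  obtain \<kappa>2 where \<kappa>2: "0 \<le> \<kappa>2" "\<And>x. x \<in> P \<Longrightarrow> 0 \<le> - (a \<bullet> (x - x0)) \<Longrightarrow>
      \<exists>y\<in>P. a \<bullet> (y - x0) = 0 \<and> norm (x - y) \<le> \<kappa>2 * - (a \<bullet> (x - x0))"
    using half[of "- a"] by auto
  have "\<exists>y\<in>P. a \<bullet> (y - x0) = 0 \<and> norm (x - y) \<le> (\<kappa>1 + \<kappa>2) * \<bar>a \<bullet> (x - x0)\<bar>" if x: "x \<in> P" for x
  proof (cases "0 \<le> a \<bullet> (x - x0)")
    case True
    then have "\<kappa>1 * (a \<bullet> (x - x0)) \<le> (\<kappa>1 + \<kappa>2) * \<bar>a \<bullet> (x - x0)\<bar>"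
      using \<kappa>2(1) by (simp add: distrib_right)
    then show ?thesis using \<kappa>1(2)[OF x True] by (meson order_trans)
  next
    case False
    then have "\<kappa>2 * - (a \<bullet> (x - x0)) \<le> (\<kappa>1 + \<kappa>2) * \<bar>a \<bullet> (x - x0)\<bar>"
      using \<kappa>1(1) by (simp add: distrib_right mult_nonneg_nonpos)
    then show ?thesis using \<kappa>2(2)[OF x] False by (meson order_trans linear neg_0_le_iff_le)
  qed
  then show ?thesis using \<kappa>1(1) \<kappa>2(1) by (meson add_nonneg_nonneg)
qed

text \<open>Hoffman's bound restricted to a polytope. The equations are satisfied one at a time: the point
  found for \<open>S\<close> is corrected inside the smaller polytope cut out by \<open>S\<close>, and its residual for the
  new equation exceeds that of \<open>x\<close> by at most a multiple of the distance already moved.\<close>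

lemma polytope_affine_error_bound:
  fixes P :: "'a::euclidean_space set"
  assumes "finite S" and "polytope P" and "x0 \<in> P"
  shows "\<exists>\<kappa>\<ge>0. \<forall>x\<in>P. \<exists>y\<in>P. (\<forall>a\<in>S. a \<bullet> (y - x0) = 0) \<and>
           norm (x - y) \<le> \<kappa> * (\<Sum>a\<in>S. \<bar>a \<bullet> (x - x0)\<bar>)"
  using assms(1)
proof (induction S rule: finite_induct)
  case empty
  show ?case by (intro exI[of _ 0]) auto
next
  case (insert a S)
  obtain \<kappa> where \<kappa>: "0 \<le> \<kappa>" "\<And>x. x \<in> P \<Longrightarrow> \<exists>y\<in>P. (\<forall>a\<in>S. a \<bullet> (y - x0) = 0) \<and>
           norm (x - y) \<le> \<kappa> * (\<Sum>a\<in>S. \<bar>a \<bullet> (x - x0)\<bar>)"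
    using insert.IH by blast
  let ?Q = "P \<inter> {x. \<forall>b\<in>S. b \<bullet> (x - x0) = 0}"
  have "{x. \<forall>b\<in>S. b \<bullet> (x - x0) = 0} = \<Inter>((\<lambda>b. {x. b \<bullet> x = b \<bullet> x0}) ` S)"
    by (auto simp: inner_diff_right)
  then have "polyhedron {x. \<forall>b\<in>S. b \<bullet> (x - x0) = 0}"
    using insert.hyps(1) by (auto intro!: polyhedron_hyperplane)
  then have "polytope ?Q" by (intro polytope_Int_polyhedron assms(2))
  moreover have "x0 \<in> ?Q" using assms(3) by simp
  ultimately obtain \<mu> where \<mu>: "0 \<le> \<mu>" "\<And>x. x \<in> ?Q \<Longrightarrow>
      \<exists>y\<in>?Q. a \<bullet> (y - x0) = 0 \<and> norm (x - y) \<le> \<mu> * \<bar>a \<bullet> (x - x0)\<bar>"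
    using polytope_hyperplane_error_bound[of ?Q x0 a] by meson
  define \<nu> where "\<nu> = \<kappa> + \<mu> + \<mu> * norm a * \<kappa>"
  have "\<exists>z\<in>P. (\<forall>b\<in>insert a S. b \<bullet> (z - x0) = 0) \<and>
      norm (x - z) \<le> \<nu> * (\<Sum>b\<in>insert a S. \<bar>b \<bullet> (x - x0)\<bar>)" if x: "x \<in> P" for x
  proof -
    let ?s = "\<Sum>b\<in>S. \<bar>b \<bullet> (x - x0)\<bar>"
    obtain y where y: "y \<in> ?Q" "norm (x - y) \<le> \<kappa> * ?s" using \<kappa>(2)[OF x] by blast
    obtain z where z: "z \<in> ?Q" "a \<bullet> (z - x0) = 0" "norm (y - z) \<le> \<mu> * \<bar>a \<bullet> (y - x0)\<bar>"
      using \<mu>(2)[OF y(1)] by blast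
    have s0: "0 \<le> ?s" by (simp add: sum_nonneg)
    have "a \<bullet> (y - x0) = a \<bullet> (x - x0) - a \<bullet> (x - y)" by (simp add: inner_diff_right)
    then have "\<bar>a \<bullet> (y - x0)\<bar> \<le> \<bar>a \<bullet> (x - x0)\<bar> + norm a * norm (x - y)"
      using Cauchy_Schwarz_ineq2[of a "x - y"] by linarith
    also have "\<dots> \<le> \<bar>a \<bullet> (x - x0)\<bar> + norm a * (\<kappa> * ?s)"
      using y(2) by (intro add_left_mono mult_left_mono) auto
    finally have "\<mu> * \<bar>a \<bullet> (y - x0)\<bar> \<le> \<mu> * (\<bar>a \<bullet> (x - x0)\<bar> + norm a * (\<kappa> * ?s))"
      using \<mu>(1) by (intro mult_left_mono)
    moreover have "norm (x - z) \<le> norm (x - y) + norm (y - z)"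
      using norm_triangle_ineq[of "x - y" "y - z"] by simp
    ultimately have "norm (x - z) \<le> \<kappa> * ?s + \<mu> * (\<bar>a \<bullet> (x - x0)\<bar> + norm a * (\<kappa> * ?s))"
      using y(2) z(3) by linarith
    also have "\<dots> = (\<kappa> + \<mu> * norm a * \<kappa>) * ?s + \<mu> * \<bar>a \<bullet> (x - x0)\<bar>" by (simp add: algebra_simps)
    also have "\<dots> \<le> \<nu> * ?s + \<nu> * \<bar>a \<bullet> (x - x0)\<bar>"
      unfolding \<nu>_def using \<kappa>(1) \<mu>(1) s0 by (intro add_mono mult_right_mono) auto
    also have "\<dots> = \<nu> * (\<Sum>b\<in>insert a S. \<bar>b \<bullet> (x - x0)\<bar>)"
      using insert.hyps by (simp add: distrib_left)
    finally show ?thesis using z by (intro bexI[of _ z]) auto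
  qed
  moreover have "0 \<le> \<nu>" unfolding \<nu>_def using \<kappa>(1) \<mu>(1) by simp
  ultimately show ?case by blast
qed

section \<open>The error bound for coercive piecewise convex quadratic functions\<close>

text \<open>Around the minimizer \<open>x0\<close> the excess \<open>q x - q x0\<close> is the sum of the nonnegative terms
  \<open>g \<bullet> d\<close> and \<open>B d\<close>, where \<open>d = x - x0\<close>, the vector \<open>g\<close> is the gradient at \<open>x0\<close> and \<open>B\<close> is a
  positive semidefinite form with symmetric part \<open>S / 2\<close>. Hence the minimizers include the points
  of \<open>P\<close> with \<open>g \<bullet> d = 0\<close> and \<open>S d = 0\<close>, and the distance to these is bounded by the residuals
  \<open>g \<bullet> d\<close>, which is at most the excess, and \<open>norm (S d)\<close>, which is at most a multiple of the
  square root of the excess because \<open>B\<close> is semidefinite.\<close>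

lemma convex_quadratic_error_bound:
  fixes P :: "'a::euclidean_space set"
  assumes q: "convex_quadratic q" and P: "polytope P" and x0: "x0 \<in> P"
    and min: "\<And>x. x \<in> P \<Longrightarrow> q x0 \<le> q x"
  shows "\<exists>C\<ge>0. \<forall>x\<in>P. \<exists>y\<in>P. q y = q x0 \<and>
           norm (x - y) \<le> C * (sqrt (q x - q x0) + (q x - q x0))"
proof -
  obtain A b c where A: "linear A" and q_eq: "\<And>x. q x = x \<bullet> A x + b \<bullet> x + c"
    and conv: "convex_on UNIV q" using q by (auto simp: convex_quadratic_def)
  have A0: "A 0 = 0" by (rule linear_0[OF A])
  define S where "S = (\<lambda>u. A u + adjoint A u)"
  have S: "v \<bullet> S u = v \<bullet> A u + A v \<bullet> u" for u v
    by (simp add: S_def inner_add_right adjoint_works[OF A])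
  have S_sym: "S v \<bullet> u = v \<bullet> S u" for u v
    by (simp add: S inner_commute[of "S v"]) (simp add: inner_commute)
  define B where "B = (\<lambda>u. u \<bullet> A u)"
  have B_nonneg: "0 \<le> B u" for u
  proof -
    have "q ((1 - 1/2) *\<^sub>R u + (1/2) *\<^sub>R (- u)) \<le> (1 - 1/2) * q u + 1/2 * q (- u)"
      by (rule convex_onD[OF conv]) auto
    then show ?thesis by (simp add: q_eq B_def linear_neg[OF A] A0 field_simps)
  qed
  define g where "g = S x0 + b"
  have expand: "q x = q x0 + g \<bullet> (x - x0) + B (x - x0)" for x
  proof -
    define d where "d = x - x0"
    have x: "x = x0 + d" by (simp add: d_def)
    have "g \<bullet> d = d \<bullet> A x0 + A d \<bullet> x0 + b \<bullet> d"
      using S[of d x0] by (simp add: g_def inner_add_left inner_add_right inner_commute)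
    then have "q (x0 + d) = q x0 + g \<bullet> d + B d"
      by (simp add: q_eq B_def linear_add[OF A] inner_simps inner_commute)
    then show ?thesis by (simp add: d_def)
  qed
  have grad_nonneg: "0 \<le> g \<bullet> (x - x0)" if x: "x \<in> P" for x
  proof (rule ccontr)
    define d e where "d = x - x0" and "e = - (g \<bullet> (x - x0))"
    assume "\<not> 0 \<le> g \<bullet> (x - x0)"
    then have e: "0 < e" by (simp add: e_def)
    \<comment> \<open>A step short enough for the negative linear term to outweigh \<open>t\<^sup>2 * B d\<close>.\<close>
    define t where "t = e / (e + B d)"
    have t: "0 < t" "t \<le> 1" using e B_nonneg[of d] by (auto simp: t_def add_pos_nonneg)
    have "t * B d < e"
    proof -
      have "e * B d < e * (e + B d)" using e by simp
      then show ?thesis using e B_nonneg[of d] by (simp add: t_def divide_less_eq add_pos_nonneg)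
    qed
    have "(1 - t) *\<^sub>R x0 + t *\<^sub>R x \<in> P"
      using convexD_alt[OF polytope_imp_convex[OF P] x0 x] t by simp
    moreover have "(1 - t) *\<^sub>R x0 + t *\<^sub>R x = x0 + t *\<^sub>R d" by (simp add: d_def algebra_simps)
    ultimately have "q x0 \<le> q (x0 + t *\<^sub>R d)" using min by simp
    also have "\<dots> = q x0 + t * (g \<bullet> d) + t * (t * B d)"
      using expand[of "x0 + t *\<^sub>R d"] by (simp add: B_def linear_scale[OF A])
    finally have "0 \<le> t * (t * B d - e)" by (simp add: d_def e_def algebra_simps)
    then show False using t \<open>t * B d < e\<close> by (simp add: zero_le_mult_iff)
  qed
  obtain M where M: "0 < M" "\<And>u. norm (A u) \<le> M * norm u"
    using linear_bounded_pos[OF A] by blast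
  \<comment> \<open>Nonnegativity of \<open>B\<close> at \<open>u - s *\<^sub>R S u\<close>, with \<open>s\<close> chosen so that the quadratic term in \<open>s\<close>
    uses up half of the linear one.\<close>
  have S_bound: "(norm (S u))\<^sup>2 \<le> 4 * M * B u" for u
  proof -
    define w s where "w = S u" and "s = 1 / (2 * M)"
    have "B w \<le> norm w * norm (A w)" unfolding B_def by (rule norm_cauchy_schwarz)
    also have "\<dots> \<le> norm w * (M * norm w)" by (intro mult_left_mono M) auto
    finally have Bw: "B w \<le> M * (norm w)\<^sup>2" by (simp add: power2_eq_square mult_ac)
    have "B (u - s *\<^sub>R w) = B u - s * (w \<bullet> A u + A w \<bullet> u) + s\<^sup>2 * B w"
      by (simp add: B_def linear_diff[OF A] linear_scale[OF A] inner_simps power2_eq_square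
          algebra_simps inner_commute)
    also have "w \<bullet> A u + A w \<bullet> u = (norm w)\<^sup>2"
      using S[of w u] by (simp add: w_def power2_norm_eq_inner)
    finally have "0 \<le> B u - s * (norm w)\<^sup>2 + s\<^sup>2 * B w" using B_nonneg[of "u - s *\<^sub>R w"] by simp
    also have "s\<^sup>2 * B w \<le> s\<^sup>2 * (M * (norm w)\<^sup>2)" by (intro mult_left_mono Bw) auto
    also have "s\<^sup>2 * (M * (norm w)\<^sup>2) = s * (norm w)\<^sup>2 / 2"
      using M by (simp add: s_def power2_eq_square)
    finally have "s * (norm w)\<^sup>2 \<le> 2 * B u" by simp
    then show ?thesis using M by (simp add: s_def w_def field_simps)
  qed
  define T where "T = insert g (S ` Basis)"
  have "finite T" by (simp add: T_def)
  from polytope_affine_error_bound[OF this P x0] obtain \<kappa> where \<kappa>: "0 \<le> \<kappa>"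
    "\<And>x. x \<in> P \<Longrightarrow> \<exists>y\<in>P. (\<forall>a\<in>T. a \<bullet> (y - x0) = 0) \<and>
         norm (x - y) \<le> \<kappa> * (\<Sum>a\<in>T. \<bar>a \<bullet> (x - x0)\<bar>)" by blast
  define n where "n = real (card (S ` Basis))"
  define C where "C = \<kappa> * (1 + n * (2 * sqrt M))"
  have C0: "0 \<le> C" using \<kappa>(1) M by (simp add: C_def n_def)
  have "\<exists>y\<in>P. q y = q x0 \<and> norm (x - y) \<le> C * (sqrt (q x - q x0) + (q x - q x0))" if x: "x \<in> P" for x
  proof -
    define d h where "d = x - x0" and "h = q x - q x0"
    obtain y where y: "y \<in> P" "\<And>a. a \<in> T \<Longrightarrow> a \<bullet> (y - x0) = 0"
      "norm (x - y) \<le> \<kappa> * (\<Sum>a\<in>T. \<bar>a \<bullet> d\<bar>)" using \<kappa>(2)[OF x] unfolding d_def by blast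
    have "S (y - x0) = 0"
    proof -
      have "i \<bullet> S (y - x0) = 0" if "i \<in> Basis" for i
        using y(2)[of "S i"] that by (simp add: T_def S_sym)
      then show ?thesis by (metis euclidean_all_zero_iff inner_commute)
    qed
    then have "B (y - x0) = 0" using S[of "y - x0" "y - x0"] by (simp add: B_def inner_commute)
    moreover have "g \<bullet> (y - x0) = 0" using y(2)[of g] by (simp add: T_def)
    ultimately have qy: "q y = q x0" using expand[of y] by simp
    have gd: "0 \<le> g \<bullet> d" unfolding d_def by (rule grad_nonneg[OF x])
    have h: "h = g \<bullet> d + B d" using expand[of x] by (simp add: h_def d_def)
    have h0: "0 \<le> h" "B d \<le> h" "g \<bullet> d \<le> h" using gd B_nonneg[of d] h by auto
    have "norm (S d) \<le> 2 * sqrt M * sqrt h"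
    proof (rule power2_le_imp_le)
      have "(norm (S d))\<^sup>2 \<le> 4 * M * h"
        using S_bound[of d] mult_left_mono[OF h0(2), of "4 * M"] M(1) by linarith
      then show "(norm (S d))\<^sup>2 \<le> (2 * sqrt M * sqrt h)\<^sup>2" using M h0 by (simp add: power_mult_distrib)
    qed (use M h0 in simp)
    have "\<bar>a \<bullet> d\<bar> \<le> 2 * sqrt M * sqrt h" if a: "a \<in> S ` Basis" for a
    proof -
      obtain i where i: "i \<in> Basis" "a = S i" using a by blast
      have "\<bar>a \<bullet> d\<bar> \<le> norm (S d)"
        using Basis_le_norm[OF i(1), of "S d"] unfolding i(2) S_sym[of i d]
        by (simp only: inner_commute)
      with \<open>norm (S d) \<le> 2 * sqrt M * sqrt h\<close> show ?thesis by linarith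
    qed
    then have "(\<Sum>a\<in>S ` Basis. \<bar>a \<bullet> d\<bar>) \<le> n * (2 * sqrt M * sqrt h)"
      unfolding n_def by (rule sum_bounded_above)
    moreover have "(\<Sum>a\<in>T. \<bar>a \<bullet> d\<bar>) \<le> \<bar>g \<bullet> d\<bar> + (\<Sum>a\<in>S ` Basis. \<bar>a \<bullet> d\<bar>)"
      unfolding T_def by (simp add: sum.insert_if)
    ultimately have "(\<Sum>a\<in>T. \<bar>a \<bullet> d\<bar>) \<le> h + n * (2 * sqrt M * sqrt h)" using gd h0 by linarith
    also have "\<dots> \<le> (1 + n * (2 * sqrt M)) * (sqrt h + h)"
    proof -
      have "0 \<le> n * (2 * sqrt M) * h + sqrt h" using M h0 by (simp add: n_def)
      then show ?thesis by (simp add: algebra_simps)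
    qed
    finally have "\<kappa> * (\<Sum>a\<in>T. \<bar>a \<bullet> d\<bar>) \<le> C * (sqrt h + h)"
      unfolding C_def using mult_left_mono[OF _ \<kappa>(1)] by (simp add: mult.assoc)
    then show ?thesis using y(1,3) qy unfolding h_def by (intro bexI[of _ y]) auto
  qed
  then show ?thesis using C0 by blast
qed

lemma min_value_eq:
  assumes "p \<in> minimizers F"
  shows "min_value F = F p"
  unfolding min_value_def using assms by (intro cInf_eq_minimum) (auto simp: minimizers_def)

text \<open>The sublevel set is bounded, so finitely many polytopes cover it. On a piece that contains a
  global minimizer the previous bound applies, as every minimizer of the quadratic on the piece is a
  global minimizer of \<open>F\<close>. On any other piece the excess is bounded away from zero by compactness,
  so that the bounded distance to a fixed minimizer suffices.\<close>

lemma piecewise_convex_quadratic_HEB: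
  fixes F :: "'a::euclidean_space \<Rightarrow> real"
  assumes pcq: "piecewise_convex_quadratic F"
    and \<alpha>: "0 < \<alpha>" and coercive: "\<And>x. \<alpha> * norm x \<le> F x + \<beta>" and "0 < \<xi>"
  shows "HEB F (1/2) (sublevel F \<xi>)"
proof -
  obtain \<P> where cont: "continuous_on UNIV F" and \<P>: "finite \<P>" "\<Union>\<P> = UNIV"
    "\<And>P. P \<in> \<P> \<Longrightarrow> polyhedron P"
    "\<And>P. P \<in> \<P> \<Longrightarrow> \<exists>q. convex_quadratic q \<and> (\<forall>x\<in>P. F x = q x)"
    using pcq unfolding piecewise_convex_quadratic_def by blast
  have bounded_level: "bounded {x. F x \<le> r}" for r
  proof (rule boundedI[of _ "(r + \<beta>) / \<alpha>"])
    fix x assume "x \<in> {x. F x \<le> r}"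
    then have "\<alpha> * norm x \<le> r + \<beta>" using coercive[of x] by simp
    then show "norm x \<le> (r + \<beta>) / \<alpha>" using \<alpha> by (simp add: field_simps)
  qed
  have closed_level: "closed {x. F x \<le> r}" for r
    using closed_Collect_le[OF cont continuous_on_const] by simp
  have compact_level: "compact {x. F x \<le> r}" for r
    using bounded_level closed_level by (simp add: compact_eq_bounded_closed)
  have cont': "continuous_on X F" for X using cont continuous_on_subset by blast
  obtain m where m0: "F m \<le> F 0" and "\<And>y. F y \<le> F 0 \<Longrightarrow> F m \<le> F y"
    using continuous_attains_inf[OF compact_level _ cont', of "F 0"] by blast
  then have m: "\<And>y. F m \<le> F y" by (meson linear order_trans)
  let ?\<Omega> = "minimizers F" let ?S = "sublevel F \<xi>"
  have m\<Omega>: "m \<in> ?\<Omega>" using m by (simp add: minimizers_def)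
  have \<Omega>: "x \<in> ?\<Omega> \<longleftrightarrow> F x = F m" for x
    using m by (auto simp: minimizers_def intro: antisym)
  have Fmin: "min_value F = F m" by (rule min_value_eq[OF m\<Omega>])
  have S: "?S = {x. F x \<le> F m + \<xi>}" by (auto simp: sublevel_def Fmin)
  obtain a where box: "?S \<subseteq> cbox (- a) a"
    using bounded_subset_cbox_symmetric[OF bounded_level] unfolding S by blast
  let ?h = "\<lambda>x. F x - F m"
  have piece: "\<exists>C\<ge>0. \<forall>x\<in>P \<inter> ?S. infdist x ?\<Omega> \<le> C * sqrt (?h x)" if P: "P \<in> \<P>" for P
  proof (cases "P \<inter> ?\<Omega> = {}")
    case False
    then obtain x0 where x0: "x0 \<in> P" "x0 \<in> ?\<Omega>" by blast
    then have Fx0: "F x0 = F m" using \<Omega> by blast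
    then have "x0 \<in> ?S" using \<open>0 < \<xi>\<close> by (simp add: S)
    let ?Q = "P \<inter> cbox (- a) a"
    obtain q where q: "convex_quadratic q" "\<And>x. x \<in> P \<Longrightarrow> F x = q x" using \<P>(4)[OF P] by blast
    have "polytope ?Q" using polyhedron_Int_polytope[OF \<P>(3)[OF P] polytope_interval] .
    moreover have "x0 \<in> ?Q" using x0 box \<open>x0 \<in> ?S\<close> by blast
    moreover have "q x0 \<le> q x" if "x \<in> ?Q" for x
      using that x0(1) m[of x] Fx0 q(2) by (metis IntD1)
    ultimately obtain C where C: "0 \<le> C" "\<And>x. x \<in> ?Q \<Longrightarrow> \<exists>y\<in>?Q. q y = q x0 \<and>
           norm (x - y) \<le> C * (sqrt (q x - q x0) + (q x - q x0))"
      using convex_quadratic_error_bound[OF q(1), of ?Q x0] by blast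
    have "infdist x ?\<Omega> \<le> C * (1 + sqrt \<xi>) * sqrt (?h x)" if x: "x \<in> P \<inter> ?S" for x
    proof -
      have "x \<in> ?Q" using x box by blast
      then obtain y where y: "y \<in> ?Q" "q y = q x0"
        "norm (x - y) \<le> C * (sqrt (q x - q x0) + (q x - q x0))" using C(2) by blast
      have "y \<in> ?\<Omega>" using y(1,2) x0(1) q(2) Fx0 \<Omega> by (metis IntD1)
      then have "infdist x ?\<Omega> \<le> dist x y" by (rule infdist_le)
      also have "\<dots> \<le> C * (sqrt (?h x) + ?h x)"
        using y(3) x x0(1) q(2) Fx0 by (simp add: dist_norm)
      also have "\<dots> \<le> C * (sqrt (?h x) + sqrt \<xi> * sqrt (?h x))"
      proof -
        have h: "0 \<le> ?h x" "?h x \<le> \<xi>" using m[of x] x by (auto simp: S)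
        have "?h x = sqrt (?h x) * sqrt (?h x)" using h by simp
        also have "\<dots> \<le> sqrt \<xi> * sqrt (?h x)" using h by (intro mult_right_mono) auto
        finally show ?thesis using C(1) by (intro mult_left_mono add_left_mono)
      qed
      finally show ?thesis by (simp add: algebra_simps)
    qed
    moreover have "0 \<le> C * (1 + sqrt \<xi>)" using C(1) \<open>0 < \<xi>\<close> by simp
    ultimately show ?thesis by blast
  next
    case True
    show ?thesis
    proof (cases "P \<inter> ?S = {}")
      case False
      have "compact (P \<inter> ?S)"
        using compact_level polyhedron_imp_closed[OF \<P>(3)[OF P]] unfolding S
        by (intro closed_Int_compact)
      then obtain p where p: "p \<in> P \<inter> ?S" "\<And>x. x \<in> P \<inter> ?S \<Longrightarrow> F p \<le> F x"
        using continuous_attains_inf[OF _ False cont'] by blast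
      have "p \<notin> ?\<Omega>" using p(1) True by blast
      then have \<eta>: "0 < ?h p" using m[of p] \<Omega>[of p] by simp
      obtain K where K: "\<And>x. x \<in> ?S \<Longrightarrow> dist m x \<le> K"
        using bounded_level bounded_any_center[of ?S m] unfolding S by blast
      have K0: "0 \<le> K" using K p(1) by (meson IntD2 order_trans zero_le_dist)
      have "infdist x ?\<Omega> \<le> K / sqrt (?h p) * sqrt (?h x)" if x: "x \<in> P \<inter> ?S" for x
      proof -
        have "infdist x ?\<Omega> \<le> dist x m" using m\<Omega> by (rule infdist_le)
        also have "\<dots> \<le> K" using K[of x] x by (simp add: dist_commute)
        also have "K = K / sqrt (?h p) * sqrt (?h p)" using \<eta> by simp
        also have "\<dots> \<le> K / sqrt (?h p) * sqrt (?h x)"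
          using K0 \<eta> p(2)[OF x] by (intro mult_left_mono) auto
        finally show ?thesis .
      qed
      moreover have "0 \<le> K / sqrt (?h p)" using K0 \<eta> by simp
      ultimately show ?thesis by blast
    qed auto
  qed
  then have "\<exists>C. \<forall>P\<in>\<P>. 0 \<le> C P \<and> (\<forall>x\<in>P \<inter> ?S. infdist x ?\<Omega> \<le> C P * sqrt (?h x))"
    by (intro bchoice) blast
  then obtain C where C0: "\<And>P. P \<in> \<P> \<Longrightarrow> 0 \<le> C P"
    and C: "\<And>P x. P \<in> \<P> \<Longrightarrow> x \<in> P \<inter> ?S \<Longrightarrow> infdist x ?\<Omega> \<le> C P * sqrt (?h x)" by blast
  define c where "c = 1 + (\<Sum>P\<in>\<P>. C P)"
  have c: "0 < c" unfolding c_def using C0 by (simp add: add_pos_nonneg sum_nonneg)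
  have "infdist x ?\<Omega> \<le> c * (F x - min_value F) powr (1/2)" if x: "x \<in> ?S" for x
  proof -
    obtain P where P: "P \<in> \<P>" "x \<in> P" using \<P>(2) by blast
    have "C P \<le> c" using member_le_sum[of P \<P> C] P(1) C0 \<P>(1) by (auto simp: c_def)
    then have "C P * sqrt (?h x) \<le> c * sqrt (?h x)" using m[of x] by (intro mult_right_mono) auto
    with C[OF P(1), of x] P x have "infdist x ?\<Omega> \<le> c * sqrt (?h x)" by auto
    then show ?thesis using powr_half_sqrt[of "?h x"] m[of x] by (simp add: Fmin)
  qed
  then show ?thesis using m\<Omega> c unfolding HEB_def HEB_constant_def by blast
qed

section \<open>Building piecewise convex quadratic functions\<close>

lemma convex_quadratic_add:
  assumes "convex_quadratic p" "convex_quadratic q"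
  shows "convex_quadratic (\<lambda>x. p x + q x)"
proof -
  obtain A b c where p: "linear A" "\<And>x. p x = x \<bullet> A x + b \<bullet> x + c"
    using assms(1) by (auto simp: convex_quadratic_def)
  obtain A' b' c' where q: "linear A'" "\<And>x. q x = x \<bullet> A' x + b' \<bullet> x + c'"
    using assms(2) by (auto simp: convex_quadratic_def)
  have "p x + q x = x \<bullet> (A x + A' x) + (b + b') \<bullet> x + (c + c')" for x
    by (simp add: p q inner_add_left inner_add_right)
  moreover have "linear (\<lambda>x. A x + A' x)" by (intro linear_compose_add p q)
  moreover have "convex_on UNIV (\<lambda>x. p x + q x)"
    using assms by (auto simp: convex_quadratic_def)
  ultimately show ?thesis unfolding convex_quadratic_def by blast
qed

lemma convex_quadratic_cmul:
  assumes "convex_quadratic p" "0 \<le> k"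
  shows "convex_quadratic (\<lambda>x. k * p x)"
proof -
  obtain A b c where p: "linear A" "\<And>x. p x = x \<bullet> A x + b \<bullet> x + c"
    using assms(1) by (auto simp: convex_quadratic_def)
  have "k * p x = x \<bullet> (k *\<^sub>R A x) + (k *\<^sub>R b) \<bullet> x + k * c" for x
    by (simp add: p algebra_simps)
  moreover have "linear (\<lambda>x. k *\<^sub>R A x)" by (intro linear_compose_scale_right p)
  moreover have "convex_on UNIV (\<lambda>x. k * p x)"
    using assms by (auto simp: convex_quadratic_def)
  ultimately show ?thesis unfolding convex_quadratic_def by blast
qed

lemma convex_on_compose_inner:
  fixes \<phi> :: "real \<Rightarrow> real"
  assumes "convex_on UNIV \<phi>"
  shows "convex_on UNIV (\<lambda>x. \<phi> (x \<bullet> v))"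
proof (rule convex_onI)
  fix t :: real and x y :: 'a assume "0 < t" "t < 1"
  then show "\<phi> (((1 - t) *\<^sub>R x + t *\<^sub>R y) \<bullet> v) \<le> (1 - t) * \<phi> (x \<bullet> v) + t * \<phi> (y \<bullet> v)"
    using convex_onD[OF assms, of t "x \<bullet> v" "y \<bullet> v"] by (simp add: inner_add_left)
qed auto

lemma convex_quadratic_affine: "convex_quadratic (\<lambda>x. b \<bullet> x + c)"
proof -
  have "convex_on UNIV (\<lambda>x. b \<bullet> x + c)"
    by (rule convex_onI) (auto simp: inner_simps algebra_simps)
  then show ?thesis
    unfolding convex_quadratic_def
    by (intro conjI exI[of _ "\<lambda>_. 0"] exI[of _ b] exI[of _ c] linearI) auto
qed

lemma convex_quadratic_compose_inner:
  fixes v :: "'a::euclidean_space"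
  assumes "convex_quadratic q"
  shows "convex_quadratic (\<lambda>x. q (x \<bullet> v))"
proof -
  obtain A and b c :: real where q: "linear A" "\<And>x. q x = x \<bullet> A x + b \<bullet> x + c"
    using assms by (auto simp: convex_quadratic_def)
  have "q (x \<bullet> v) = x \<bullet> (A (x \<bullet> v) *\<^sub>R v) + (b *\<^sub>R v) \<bullet> x + c" for x
    by (simp add: q inner_commute mult.commute)
  moreover have "linear (\<lambda>x. A (x \<bullet> v) *\<^sub>R v)"
    by (rule linearI) (simp_all add: inner_add_left linear_add[OF q(1)] scaleR_add_left
        linear_scale[OF q(1), of _ "_ \<bullet> v", simplified])
  moreover have "convex_on UNIV (\<lambda>x. q (x \<bullet> v))"
    using assms by (intro convex_on_compose_inner) (simp add: convex_quadratic_def)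
  ultimately show ?thesis unfolding convex_quadratic_def by blast
qed

lemma polyhedron_vimage_inner:
  fixes P :: "real set" and v :: "'a::euclidean_space"
  assumes "polyhedron P"
  shows "polyhedron {x. x \<bullet> v \<in> P}"
proof -
  obtain \<H> where \<H>: "finite \<H>" "P = \<Inter>\<H>"
    and half: "\<forall>H\<in>\<H>. \<exists>a b. a \<noteq> 0 \<and> H = {z. a \<bullet> z \<le> b}"
    using assms unfolding polyhedron_def by (elim exE conjE)
  have "polyhedron {x. x \<bullet> v \<in> H}" if H: "H \<in> \<H>" for H
  proof -
    obtain a b where "H = {z. a \<bullet> z \<le> b}" using bspec[OF half H] by (elim exE conjE)
    then have "{x. x \<bullet> v \<in> H} = {x. (a *\<^sub>R v) \<bullet> x \<le> b}" by (simp add: inner_commute)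
    then show ?thesis by (simp only: polyhedron_halfspace_le)
  qed
  moreover have "{x. x \<bullet> v \<in> P} = \<Inter>((\<lambda>H. {x. x \<bullet> v \<in> H}) ` \<H>)" using \<H>(2) by auto
  ultimately show ?thesis using \<H>(1) by auto
qed

text \<open>The common refinement of the two subdivisions serves the sum.\<close>

lemma piecewise_convex_quadratic_add:
  assumes "piecewise_convex_quadratic F" "piecewise_convex_quadratic G"
  shows "piecewise_convex_quadratic (\<lambda>x. F x + G x)"
proof -
  obtain \<P> where \<P>: "continuous_on UNIV F" "finite \<P>" "\<Union>\<P> = UNIV"
    "\<And>P. P \<in> \<P> \<Longrightarrow> polyhedron P \<and> (\<exists>q. convex_quadratic q \<and> (\<forall>x\<in>P. F x = q x))"
    using assms(1) unfolding piecewise_convex_quadratic_def by blast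
  obtain \<Q> where \<Q>: "continuous_on UNIV G" "finite \<Q>" "\<Union>\<Q> = UNIV"
    "\<And>P. P \<in> \<Q> \<Longrightarrow> polyhedron P \<and> (\<exists>q. convex_quadratic q \<and> (\<forall>x\<in>P. G x = q x))"
    using assms(2) unfolding piecewise_convex_quadratic_def by blast
  let ?R = "(\<lambda>(P, Q). P \<inter> Q) ` (\<P> \<times> \<Q>)"
  have cont: "continuous_on UNIV (\<lambda>x. F x + G x)" by (intro continuous_on_add \<P> \<Q>)
  have fin: "finite ?R" using \<P> \<Q> by simp
  have cover: "\<Union>?R = UNIV"
  proof -
    have "x \<in> \<Union>?R" for x
    proof -
      obtain P Q where "P \<in> \<P>" "x \<in> P" "Q \<in> \<Q>" "x \<in> Q" using \<P>(3) \<Q>(3) by blast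
      then show ?thesis by auto
    qed
    then show ?thesis by blast
  qed
  have pieces: "\<forall>X\<in>?R. polyhedron X \<and> (\<exists>q. convex_quadratic q \<and> (\<forall>x\<in>X. F x + G x = q x))"
  proof
    fix X assume X: "X \<in> ?R"
    obtain P Q where PQ: "P \<in> \<P>" "Q \<in> \<Q>" "X = P \<inter> Q" using X by auto
    obtain p q where "convex_quadratic p" "\<forall>x\<in>P. F x = p x" "convex_quadratic q" "\<forall>x\<in>Q. G x = q x"
      using \<P>(4)[OF PQ(1)] \<Q>(4)[OF PQ(2)] by blast
    then have "convex_quadratic (\<lambda>x. p x + q x) \<and> (\<forall>x\<in>X. F x + G x = p x + q x)"
      using PQ(3) by (simp add: convex_quadratic_add)
    moreover have "polyhedron X" using \<P>(4)[OF PQ(1)] \<Q>(4)[OF PQ(2)] PQ(3) by simp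
    ultimately show "polyhedron X \<and> (\<exists>q. convex_quadratic q \<and> (\<forall>x\<in>X. F x + G x = q x))"
      by (intro conjI exI[of _ "\<lambda>x. p x + q x"]) blast+
  qed
  show ?thesis
    unfolding piecewise_convex_quadratic_def
    by (intro conjI exI[of _ ?R] cont fin cover pieces)
qed

lemma piecewise_convex_quadratic_cmul:
  assumes "piecewise_convex_quadratic F" "0 \<le> k"
  shows "piecewise_convex_quadratic (\<lambda>x. k * F x)"
proof -
  obtain \<P> where \<P>: "continuous_on UNIV F" "finite \<P>" "\<Union>\<P> = UNIV"
    "\<And>P. P \<in> \<P> \<Longrightarrow> polyhedron P \<and> (\<exists>q. convex_quadratic q \<and> (\<forall>x\<in>P. F x = q x))"
    using assms(1) unfolding piecewise_convex_quadratic_def by blast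
  have pieces: "\<forall>P\<in>\<P>. polyhedron P \<and> (\<exists>q. convex_quadratic q \<and> (\<forall>x\<in>P. k * F x = q x))"
  proof
    fix P assume P: "P \<in> \<P>"
    obtain q where "convex_quadratic q" "\<forall>x\<in>P. F x = q x" using \<P>(4)[OF P] by blast
    then show "polyhedron P \<and> (\<exists>q. convex_quadratic q \<and> (\<forall>x\<in>P. k * F x = q x))"
      using assms(2) \<P>(4)[OF P]
      by (intro conjI exI[of _ "\<lambda>x. k * q x"]) (simp_all add: convex_quadratic_cmul)
  qed
  have cont: "continuous_on UNIV (\<lambda>x. k * F x)" by (intro continuous_on_mult_left \<P>)
  show ?thesis
    unfolding piecewise_convex_quadratic_def
    by (intro conjI exI[of _ \<P>] cont \<P>(2,3) pieces)
qed

lemma piecewise_convex_quadratic_sum: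
  fixes F :: "'i \<Rightarrow> 'a::euclidean_space \<Rightarrow> real"
  assumes "finite I" "\<And>i. i \<in> I \<Longrightarrow> piecewise_convex_quadratic (F i)"
  shows "piecewise_convex_quadratic (\<lambda>x. \<Sum>i\<in>I. F i x)"
  using assms
proof (induction I rule: finite_induct)
  case empty
  have "convex_quadratic (\<lambda>x::'a. 0)" using convex_quadratic_affine[of 0 0] by simp
  then show ?case
    unfolding piecewise_convex_quadratic_def by (intro conjI exI[of _ "{UNIV}"] ballI) auto
next
  case (insert i I)
  then show ?case using piecewise_convex_quadratic_add[of "F i" "\<lambda>x. \<Sum>i\<in>I. F i x"] by simp
qed

lemma piecewise_convex_quadratic_compose_inner:
  fixes v :: "'a::euclidean_space"
  assumes "piecewise_convex_quadratic \<phi>"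
  shows "piecewise_convex_quadratic (\<lambda>x. \<phi> (x \<bullet> v))"
proof -
  obtain \<P> where \<P>: "continuous_on UNIV \<phi>" "finite \<P>" "\<Union>\<P> = UNIV"
    "\<And>P. P \<in> \<P> \<Longrightarrow> polyhedron P \<and> (\<exists>q. convex_quadratic q \<and> (\<forall>x\<in>P. \<phi> x = q x))"
    using assms unfolding piecewise_convex_quadratic_def by blast
  let ?R = "(\<lambda>P. {x. x \<bullet> v \<in> P}) ` \<P>"
  have cont: "continuous_on UNIV (\<lambda>x. \<phi> (x \<bullet> v))"
    by (rule continuous_on_compose2[OF \<P>(1)]) (auto intro: continuous_intros)
  have fin: "finite ?R" using \<P> by simp
  have cover: "\<Union>?R = UNIV" using \<P>(3) by blast
  have pieces: "\<forall>X\<in>?R. polyhedron X \<and> (\<exists>q. convex_quadratic q \<and> (\<forall>x\<in>X. \<phi> (x \<bullet> v) = q x))"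
  proof
    fix X assume X: "X \<in> ?R"
    obtain P where P: "P \<in> \<P>" "X = {x. x \<bullet> v \<in> P}" using X by auto
    obtain q where "convex_quadratic q" "\<forall>x\<in>P. \<phi> x = q x" using \<P>(4)[OF P(1)] by blast
    then have "convex_quadratic (\<lambda>x. q (x \<bullet> v)) \<and> (\<forall>x\<in>X. \<phi> (x \<bullet> v) = q (x \<bullet> v))"
      using P(2) by (simp add: convex_quadratic_compose_inner)
    moreover have "polyhedron X" using \<P>(4)[OF P(1)] P(2) by (simp add: polyhedron_vimage_inner)
    ultimately show "polyhedron X \<and> (\<exists>q. convex_quadratic q \<and> (\<forall>x\<in>X. \<phi> (x \<bullet> v) = q x))"
      by (intro conjI exI[of _ "\<lambda>x. q (x \<bullet> v)"]) blast+
  qed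
  show ?thesis
    unfolding piecewise_convex_quadratic_def
    by (intro conjI exI[of _ ?R] cont fin cover pieces)
qed

text \<open>A function that is everywhere equal to one of its affine minorants is a supremum of affine
  functions. This spares a case analysis over the pieces of each regularizer.\<close>

lemma convex_on_if_affine_minorants:
  fixes F :: "'a::real_inner \<Rightarrow> real"
  assumes "\<And>z. \<exists>a b. F z = a \<bullet> z + b \<and> (\<forall>x. a \<bullet> x + b \<le> F x)"
  shows "convex_on UNIV F"
proof (rule convex_onI)
  fix t :: real and x y assume t: "0 < t" "t < 1"
  obtain a b where ab: "F ((1 - t) *\<^sub>R x + t *\<^sub>R y) = a \<bullet> ((1 - t) *\<^sub>R x + t *\<^sub>R y) + b"
    "\<And>x. a \<bullet> x + b \<le> F x" using assms by blast
  have "F ((1 - t) *\<^sub>R x + t *\<^sub>R y) = (1 - t) * (a \<bullet> x + b) + t * (a \<bullet> y + b)"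
    unfolding ab(1) by (simp add: inner_add_right algebra_simps)
  also have "\<dots> \<le> (1 - t) * F x + t * F y" using t ab(2) by (intro add_mono mult_left_mono) auto
  finally show "F ((1 - t) *\<^sub>R x + t *\<^sub>R y) \<le> (1 - t) * F x + t * F y" .
qed auto

text \<open>The pieces of a maximum of finitely many linear functions are the sets where a given one is
  maximal; each is cut out by comparisons with the others.\<close>

lemma support_function_convex_pcq:
  fixes F :: "'a::euclidean_space \<Rightarrow> real"
  assumes "finite S" and bound: "\<forall>a\<in>S. \<forall>x. a \<bullet> x \<le> F x" and attained: "\<forall>x. \<exists>a\<in>S. F x = a \<bullet> x"
  shows "convex_on UNIV F" and "piecewise_convex_quadratic F"
proof -
  have le: "a \<bullet> x \<le> F x" if "a \<in> S" for a x using bound that by blast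
  have att: "\<exists>a\<in>S. F x = a \<bullet> x" for x using attained by blast
  have "\<exists>a b. F z = a \<bullet> z + b \<and> (\<forall>x. a \<bullet> x + b \<le> F x)" for z
  proof -
    obtain a where "a \<in> S" "F z = a \<bullet> z" using att by blast
    then show ?thesis using le by (intro exI[of _ a] exI[of _ 0]) simp
  qed
  then show "convex_on UNIV F" by (rule convex_on_if_affine_minorants)
  then have cont: "continuous_on UNIV F" by (rule convex_on_continuous[OF open_UNIV])
  let ?P = "\<lambda>a. \<Inter>b\<in>S. {x. (b - a) \<bullet> x \<le> 0}"
  have P: "?P a = {x. F x = a \<bullet> x}" if "a \<in> S" for a
  proof (intro Set.set_eqI iffI)
    fix x assume x: "x \<in> ?P a"
    obtain b where "b \<in> S" "F x = b \<bullet> x" using att by blast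
    then have "F x \<le> a \<bullet> x" using x by (simp add: inner_diff_left)
    then show "x \<in> {x. F x = a \<bullet> x}" using le[OF that] by (simp add: antisym)
  next
    fix x assume "x \<in> {x. F x = a \<bullet> x}"
    then have "b \<bullet> x \<le> a \<bullet> x" if "b \<in> S" for b using le[OF that, of x] by simp
    then show "x \<in> ?P a" by (simp add: inner_diff_left)
  qed
  have fin: "finite (?P ` S)" using assms(1) by simp
  have cover: "\<Union>(?P ` S) = UNIV"
  proof -
    have "x \<in> \<Union>(?P ` S)" for x
    proof -
      obtain a where "a \<in> S" "F x = a \<bullet> x" using att by blast
      then have "x \<in> ?P a" using P by blast
      then show ?thesis using \<open>a \<in> S\<close> by (rule UN_I[rotated])
    qed
    then show ?thesis by blast
  qed
  have pieces: "\<forall>X\<in>?P ` S. polyhedron X \<and> (\<exists>q. convex_quadratic q \<and> (\<forall>x\<in>X. F x = q x))"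
  proof
    fix X assume X: "X \<in> ?P ` S"
    obtain a where a: "a \<in> S" "X = ?P a" using X by blast
    have "polyhedron X" unfolding a(2)
      using assms(1) polyhedron_halfspace_le by (intro polyhedron_Inter) auto
    moreover have "\<forall>x\<in>X. F x = a \<bullet> x + 0" unfolding a(2) P[OF a(1)] by simp
    ultimately show "polyhedron X \<and> (\<exists>q. convex_quadratic q \<and> (\<forall>x\<in>X. F x = q x))"
      using convex_quadratic_affine[of a 0] by blast
  qed
  show "piecewise_convex_quadratic F"
    unfolding piecewise_convex_quadratic_def
    by (intro conjI exI[of _ "?P ` S"] cont fin cover pieces)
qed

section \<open>Convexity, pieces and growth of the regularizers\<close>

lemma sum_convex_on:
  assumes "finite I" "\<And>i. i \<in> I \<Longrightarrow> convex_on UNIV (F i)"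
  shows "convex_on UNIV (\<lambda>x. \<Sum>i\<in>I. F i x)"
  using assms
proof (induction I rule: finite_induct)
  case empty
  show ?case unfolding sum.empty convex_on_const by (rule convex_UNIV)
next
  case (insert i I)
  have "convex_on UNIV (\<lambda>x. F i x + (\<Sum>i\<in>I. F i x))"
    using insert.prems by (intro convex_on_add insert.IH) simp_all
  then show ?case by (simp only: sum.insert[OF insert.hyps])
qed

lemma abs_convex_pcq:
  "convex_on UNIV (abs :: real \<Rightarrow> real)" "piecewise_convex_quadratic (abs :: real \<Rightarrow> real)"
proof -
  have "finite {1, - 1 :: real}" "\<forall>a\<in>{1, - 1 :: real}. \<forall>x. a \<bullet> x \<le> \<bar>x\<bar>"
    by (simp_all add: abs_if)
  moreover have "\<forall>x. \<exists>a\<in>{1, - 1 :: real}. \<bar>x\<bar> = a \<bullet> x"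
  proof
    fix x :: real
    show "\<exists>a\<in>{1, - 1 :: real}. \<bar>x\<bar> = a \<bullet> x"
      by (intro bexI[of _ "if x < 0 then - 1 else 1"]) (simp_all add: abs_if)
  qed
  ultimately have *: "finite {1, - 1 :: real}" "\<forall>a\<in>{1, - 1 :: real}. \<forall>x. a \<bullet> x \<le> \<bar>x\<bar>"
    "\<forall>x. \<exists>a\<in>{1, - 1 :: real}. \<bar>x\<bar> = a \<bullet> x" by blast+
  from support_function_convex_pcq[OF *]
  show "convex_on UNIV (abs :: real \<Rightarrow> real)" "piecewise_convex_quadratic (abs :: real \<Rightarrow> real)" .
qed

text \<open>The Huber function is the maximum of the affine functions \<open>\<lambda>x. s * x - s\<^sup>2 / 2\<close> over
  \<open>\<bar>s\<bar> \<le> \<delta>\<close>, attained where \<open>s\<close> is \<open>x\<close> clipped to \<open>[-\<delta>, \<delta>]\<close>.\<close>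

lemma huber_convex_pcq:
  assumes "0 < \<delta>"
  shows "convex_on UNIV (huber \<delta>)" and "piecewise_convex_quadratic (huber \<delta>)"
proof -
  have minorant: "s * x - s\<^sup>2 / 2 \<le> huber \<delta> x" if "\<bar>s\<bar> \<le> \<delta>" for s x
  proof (cases "\<bar>x\<bar> \<ge> \<delta>")
    case True
    have "s * x \<le> \<bar>s\<bar> * \<bar>x\<bar>" using abs_ge_self[of "s * x"] by (simp only: abs_mult)
    moreover have "0 \<le> (\<delta> - \<bar>s\<bar>) * (2 * \<bar>x\<bar> - \<delta> - \<bar>s\<bar>)" using that True by simp
    moreover have "(\<delta> - \<bar>s\<bar>) * (2 * \<bar>x\<bar> - \<delta> - \<bar>s\<bar>)
        = 2 * (\<delta> * (\<bar>x\<bar> - \<delta> / 2)) - 2 * (\<bar>s\<bar> * \<bar>x\<bar>) + s\<^sup>2"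
      by (simp add: power2_eq_square algebra_simps)
    ultimately show ?thesis using True by (simp add: huber_def)
  next
    case False
    have "0 \<le> s\<^sup>2 - 2 * (s * x) + x\<^sup>2"
      using zero_le_power2[of "s - x"] unfolding power2_diff by (simp add: mult.assoc)
    then show ?thesis using False by (simp add: huber_def)
  qed
  have "\<exists>a b. huber \<delta> z = a \<bullet> z + b \<and> (\<forall>x. a \<bullet> x + b \<le> huber \<delta> x)" for z
  proof -
    define s where "s = (if \<bar>z\<bar> \<ge> \<delta> then sgn z * \<delta> else z)"
    have "\<bar>s\<bar> \<le> \<delta>" using assms by (simp add: s_def sgn_if)
    moreover have "huber \<delta> z = s * z - s\<^sup>2 / 2"
    proof (cases "\<bar>z\<bar> \<ge> \<delta>")
      case True
      then have "s * z = \<delta> * \<bar>z\<bar>" "s\<^sup>2 = \<delta>\<^sup>2"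
        using assms by (auto simp: s_def sgn_if)
      then show ?thesis using True by (simp add: huber_def power2_eq_square right_diff_distrib)
    qed (simp add: s_def huber_def power2_eq_square)
    ultimately show ?thesis
      using minorant[of s] by (intro exI[of _ s] exI[of _ "- s\<^sup>2 / 2"]) simp
  qed
  then show "convex_on UNIV (huber \<delta>)" by (rule convex_on_if_affine_minorants)
  then have cont: "continuous_on UNIV (huber \<delta>)" by (rule convex_on_continuous[OF open_UNIV])
  let ?L = "{x::real. 1 \<bullet> x \<le> - \<delta>}" let ?U = "{x::real. 1 \<bullet> x \<ge> \<delta>}"
  let ?M = "{x::real. 1 \<bullet> x \<ge> - \<delta>} \<inter> {x. 1 \<bullet> x \<le> \<delta>}"
  have "convex_quadratic (\<lambda>x::real. x\<^sup>2 / 2)"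
    unfolding convex_quadratic_def
  proof (intro conjI exI[of _ "\<lambda>x. x / 2"] exI[of _ 0] allI)
    show "convex_on UNIV (\<lambda>x::real. x\<^sup>2 / 2)"
      using convex_on_cmul[OF _ convex_power2, of "1/2"] by simp
    show "linear (\<lambda>x::real. x / 2)" by (rule linearI) (auto simp: field_simps)
  qed (simp add: power2_eq_square)
  moreover have "\<forall>x\<in>?M. huber \<delta> x = x\<^sup>2 / 2"
  proof
    fix x assume x: "x \<in> ?M"
    have "x = \<delta> \<or> x = - \<delta>" if "\<bar>x\<bar> \<ge> \<delta>" using that x by (simp add: abs_if split: if_splits)
    then show "huber \<delta> x = x\<^sup>2 / 2"
      using assms by (cases "\<bar>x\<bar> \<ge> \<delta>") (auto simp: huber_def power2_eq_square)
  qed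
  ultimately have M: "\<exists>q. convex_quadratic q \<and> (\<forall>x\<in>?M. huber \<delta> x = q x)" by blast
  have "\<forall>x\<in>?L. huber \<delta> x = (- \<delta>) \<bullet> x + - (\<delta>\<^sup>2 / 2)"
    using assms by (simp add: huber_def power2_eq_square abs_if algebra_simps)
  then have Lo: "\<exists>q. convex_quadratic q \<and> (\<forall>x\<in>?L. huber \<delta> x = q x)"
    using convex_quadratic_affine by blast
  have "\<forall>x\<in>?U. huber \<delta> x = \<delta> \<bullet> x + - (\<delta>\<^sup>2 / 2)"
    using assms by (simp add: huber_def power2_eq_square abs_if algebra_simps)
  then have Up: "\<exists>q. convex_quadratic q \<and> (\<forall>x\<in>?U. huber \<delta> x = q x)"
    using convex_quadratic_affine by blast
  have poly: "polyhedron ?L" "polyhedron ?M" "polyhedron ?U"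
    by (intro polyhedron_Int polyhedron_halfspace_le polyhedron_halfspace_ge)+
  have "\<Union>{?L, ?M, ?U} = UNIV" by auto
  then show "piecewise_convex_quadratic (huber \<delta>)"
    unfolding piecewise_convex_quadratic_def
    using cont M Lo Up poly by (intro conjI exI[of _ "{?L, ?M, ?U}"] ballI) auto
qed

lemma separable_convex_pcq:
  fixes \<phi> :: "real \<Rightarrow> real"
  assumes "convex_on UNIV \<phi>" "piecewise_convex_quadratic \<phi>"
  shows "convex_on UNIV (\<lambda>x :: real ^ 'd. \<Sum>i\<in>UNIV. \<phi> (x $ i))"
    and "piecewise_convex_quadratic (\<lambda>x :: real ^ 'd. \<Sum>i\<in>UNIV. \<phi> (x $ i))"
proof -
  have "convex_on UNIV (\<lambda>x :: real ^ 'd. \<phi> (x \<bullet> axis i 1))"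
    "piecewise_convex_quadratic (\<lambda>x :: real ^ 'd. \<phi> (x \<bullet> axis i 1))" for i
    by (intro convex_on_compose_inner piecewise_convex_quadratic_compose_inner assms)+
  then have "convex_on UNIV (\<lambda>x :: real ^ 'd. \<phi> (x $ i))"
    "piecewise_convex_quadratic (\<lambda>x :: real ^ 'd. \<phi> (x $ i))" for i
    by (auto simp: inner_axis)
  then show "convex_on UNIV (\<lambda>x :: real ^ 'd. \<Sum>i\<in>UNIV. \<phi> (x $ i))"
    "piecewise_convex_quadratic (\<lambda>x :: real ^ 'd. \<Sum>i\<in>UNIV. \<phi> (x $ i))"
    by (intro sum_convex_on piecewise_convex_quadratic_sum; simp)+
qed

lemma infnorm_support:
  fixes x :: "'a::euclidean_space"
  defines "S \<equiv> Basis \<union> uminus ` (Basis :: 'a set)"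
  shows "a \<in> S \<Longrightarrow> a \<bullet> x \<le> infnorm x" and "\<exists>a\<in>S. infnorm x = a \<bullet> x"
proof -
  show "a \<bullet> x \<le> infnorm x" if a: "a \<in> S"
  proof -
    obtain i where i: "i \<in> Basis" "a = i \<or> a = - i" using a by (auto simp: S_def)
    have "a \<bullet> x \<le> \<bar>x \<bullet> i\<bar>" using i(2) by (auto simp: inner_commute)
    with Basis_le_infnorm[OF i(1), of x] show ?thesis by linarith
  qed
  have "infnorm x \<in> (\<lambda>i. \<bar>x \<bullet> i\<bar>) ` Basis" unfolding infnorm_Max by (intro Max_in) auto
  then obtain i where i: "i \<in> Basis" "infnorm x = \<bar>x \<bullet> i\<bar>" by blast
  then have "infnorm x = i \<bullet> x \<or> infnorm x = (- i) \<bullet> x" by (auto simp: abs_if inner_commute)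
  then show "\<exists>a\<in>S. infnorm x = a \<bullet> x"
    using i(1) unfolding S_def by (meson UnI1 UnI2 imageI)
qed

lemma infnorm_convex_pcq:
  shows "convex_on UNIV (infnorm :: 'a::euclidean_space \<Rightarrow> real)"
    and "piecewise_convex_quadratic (infnorm :: 'a::euclidean_space \<Rightarrow> real)"
proof -
  let ?S = "Basis \<union> uminus ` (Basis :: 'a set)"
  have "finite ?S" by simp
  moreover have "\<forall>a\<in>?S. \<forall>x. a \<bullet> x \<le> infnorm x" using infnorm_support(1) by (intro ballI allI)
  moreover have "\<forall>x. \<exists>a\<in>?S. infnorm x = a \<bullet> x" using infnorm_support(2) by (intro allI)
  ultimately show "convex_on UNIV (infnorm :: 'a \<Rightarrow> real)"
    "piecewise_convex_quadratic (infnorm :: 'a \<Rightarrow> real)"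
    by (rule support_function_convex_pcq)+
qed

text \<open>Each summand \<open>infnorm (x $ m)\<close> is a maximum of linear functions of the whole tuple \<open>x\<close>.\<close>

lemma l1_inf_norm_convex_pcq:
  shows "convex_on UNIV (l1_inf_norm :: real ^ 'd ^ 'm \<Rightarrow> real)"
    and "piecewise_convex_quadratic (l1_inf_norm :: real ^ 'd ^ 'm \<Rightarrow> real)"
proof -
  let ?S = "Basis \<union> uminus ` (Basis :: (real ^ 'd) set)"
  have "convex_on UNIV (\<lambda>x :: real ^ 'd ^ 'm. infnorm (x $ m)) \<and>
    piecewise_convex_quadratic (\<lambda>x :: real ^ 'd ^ 'm. infnorm (x $ m))" for m
  proof -
    have fin: "finite (axis m ` ?S :: (real ^ 'd ^ 'm) set)" by simp
    have le: "\<forall>a\<in>axis m ` ?S. \<forall>x :: real ^ 'd ^ 'm. a \<bullet> x \<le> infnorm (x $ m)"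
    proof (intro ballI allI)
      fix a and x :: "real ^ 'd ^ 'm" assume "a \<in> axis m ` ?S"
      then obtain s where "s \<in> ?S" "a = axis m s" by (rule imageE)
      then show "a \<bullet> x \<le> infnorm (x $ m)"
        using infnorm_support(1) by (simp only: inner_axis')
    qed
    have att: "\<forall>x :: real ^ 'd ^ 'm. \<exists>a\<in>axis m ` ?S. infnorm (x $ m) = a \<bullet> x"
    proof
      fix x :: "real ^ 'd ^ 'm"
      obtain s where "s \<in> ?S" "infnorm (x $ m) = s \<bullet> (x $ m)"
        using infnorm_support(2)[of "x $ m"] by (rule bexE)
      then show "\<exists>a\<in>axis m ` ?S. infnorm (x $ m) = a \<bullet> x"
        by (intro bexI[of _ "axis m s"] imageI) (simp_all only: inner_axis')
    qed
    show ?thesis using support_function_convex_pcq[OF fin le att] by blast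
  qed
  then show "convex_on UNIV (l1_inf_norm :: real ^ 'd ^ 'm \<Rightarrow> real)"
    "piecewise_convex_quadratic (l1_inf_norm :: real ^ 'd ^ 'm \<Rightarrow> real)"
    unfolding l1_inf_norm_def[abs_def] by (intro sum_convex_on piecewise_convex_quadratic_sum; simp)+
qed

text \<open>Each regularizer grows at least linearly, which a nonnegative loss preserves; this bounds the
  sublevel sets of the objectives.\<close>

lemma norm_le_sqrt_DIM_infnorm:
  fixes x :: "'a::euclidean_space"
  shows "1 / sqrt DIM('a) * norm x \<le> infnorm x"
  using norm_le_infnorm[of x] by (simp add: field_simps)

lemma norm_le_l1_inf_norm:
  fixes x :: "real ^ 'd ^ 'm"
  shows "1 / sqrt DIM(real ^ 'd) * norm x \<le> l1_inf_norm x"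
proof -
  have "norm x \<le> (\<Sum>m\<in>UNIV. norm (x $ m))"
    unfolding norm_vec_def by (rule L2_set_le_sum) simp
  then have "1 / sqrt DIM(real ^ 'd) * norm x \<le> 1 / sqrt DIM(real ^ 'd) * (\<Sum>m\<in>UNIV. norm (x $ m))"
    by (intro mult_left_mono) auto
  also have "\<dots> = (\<Sum>m\<in>UNIV. 1 / sqrt DIM(real ^ 'd) * norm (x $ m))" by (rule sum_distrib_left)
  also have "\<dots> \<le> l1_inf_norm x"
    unfolding l1_inf_norm_def by (intro sum_mono norm_le_sqrt_DIM_infnorm)
  finally show ?thesis .
qed

lemma norm_le_huber_norm:
  fixes x :: "real ^ 'd"
  assumes "0 < \<delta>"
  shows "\<delta> * norm x \<le> huber_norm \<delta> x + real CARD('d) * (\<delta>\<^sup>2 / 2)"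
proof -
  have "\<delta> * \<bar>t\<bar> \<le> huber \<delta> t + \<delta>\<^sup>2 / 2" for t
  proof (cases "\<bar>t\<bar> \<ge> \<delta>")
    case False
    have "0 \<le> (\<bar>t\<bar> - \<delta>)\<^sup>2" by simp
    also have "\<dots> = t\<^sup>2 - 2 * (\<delta> * \<bar>t\<bar>) + \<delta>\<^sup>2" unfolding power2_diff by (simp add: mult.commute)
    finally show ?thesis using False by (simp add: huber_def)
  qed (simp add: huber_def power2_eq_square algebra_simps)
  then have "(\<Sum>i\<in>UNIV. \<delta> * \<bar>x $ i\<bar>) \<le> (\<Sum>i\<in>UNIV. huber \<delta> (x $ i) + \<delta>\<^sup>2 / 2)" by (intro sum_mono)
  also have "\<dots> = huber_norm \<delta> x + real CARD('d) * (\<delta>\<^sup>2 / 2)"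
    by (simp add: huber_norm_def sum.distrib)
  finally have "\<delta> * (\<Sum>i\<in>UNIV. \<bar>x $ i\<bar>) \<le> huber_norm \<delta> x + real CARD('d) * (\<delta>\<^sup>2 / 2)"
    by (simp add: sum_distrib_left)
  moreover have "\<delta> * norm x \<le> \<delta> * (\<Sum>i\<in>UNIV. \<bar>x $ i\<bar>)"
    using assms norm_le_l1_cart[of x] by (intro mult_left_mono) auto
  ultimately show ?thesis by linarith
qed

section \<open>Strongly convex functions and their minimizers\<close>

text \<open>Stated as an inequality on segments, strong convexity passes to sums and multiples at once and
  yields quadratic growth at a minimizer without subgradients.\<close>

definition strongly_convex :: "real \<Rightarrow> ('a::real_inner \<Rightarrow> real) \<Rightarrow> bool" where
  "strongly_convex \<mu> h \<longleftrightarrow> (\<forall>x y s. 0 \<le> s \<longrightarrow> s \<le> 1 \<longrightarrow>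
     h ((1 - s) *\<^sub>R x + s *\<^sub>R y)
       \<le> (1 - s) * h x + s * h y - \<mu> / 2 * (s * (1 - s)) * (norm (x - y))\<^sup>2)"

lemma strongly_convexD:
  assumes "strongly_convex \<mu> h" "0 \<le> s" "s \<le> 1"
  shows "h ((1 - s) *\<^sub>R x + s *\<^sub>R y)
       \<le> (1 - s) * h x + s * h y - \<mu> / 2 * (s * (1 - s)) * (norm (x - y))\<^sup>2"
  using assms unfolding strongly_convex_def by blast

lemma convex_imp_strongly_convex_0: "convex_on UNIV h \<Longrightarrow> strongly_convex 0 h"
  by (simp add: strongly_convex_def convex_onD)

lemma strongly_convex_imp_convex:
  assumes "strongly_convex \<mu> h" "0 \<le> \<mu>"
  shows "convex_on UNIV h"
proof (rule convex_onI)
  fix s :: real and x y :: 'a assume s: "0 < s" "s < 1"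
  have "0 \<le> \<mu> / 2 * (s * (1 - s)) * (norm (x - y))\<^sup>2" using s assms(2) by simp
  then show "h ((1 - s) *\<^sub>R x + s *\<^sub>R y) \<le> (1 - s) * h x + s * h y"
    using strongly_convexD[OF assms(1), of s x y] s by linarith
qed auto

lemma strongly_convex_add:
  assumes "strongly_convex \<mu> h" "strongly_convex \<nu> k"
  shows "strongly_convex (\<mu> + \<nu>) (\<lambda>x. h x + k x)"
  unfolding strongly_convex_def
proof (intro allI impI)
  fix x y and s :: real assume s: "0 \<le> s" "s \<le> 1"
  show "h ((1 - s) *\<^sub>R x + s *\<^sub>R y) + k ((1 - s) *\<^sub>R x + s *\<^sub>R y)
     \<le> (1 - s) * (h x + k x) + s * (h y + k y)
        - (\<mu> + \<nu>) / 2 * (s * (1 - s)) * (norm (x - y))\<^sup>2"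
    using strongly_convexD[OF assms(1) s, of x y] strongly_convexD[OF assms(2) s, of x y]
    by (simp add: distrib_left distrib_right add_divide_distrib)
qed

lemma strongly_convex_scale:
  assumes "strongly_convex \<mu> h" "0 \<le> c"
  shows "strongly_convex (c * \<mu>) (\<lambda>x. c * h x)"
  unfolding strongly_convex_def
proof (intro allI impI)
  fix x y and s :: real assume s: "0 \<le> s" "s \<le> 1"
  show "c * h ((1 - s) *\<^sub>R x + s *\<^sub>R y)
     \<le> (1 - s) * (c * h x) + s * (c * h y) - c * \<mu> / 2 * (s * (1 - s)) * (norm (x - y))\<^sup>2"
    using mult_left_mono[OF strongly_convexD[OF assms(1) s, of x y] assms(2)]
    by (simp add: algebra_simps)
qed

lemma strongly_convex_half_sq_dist: "strongly_convex 1 (\<lambda>x. (norm (x - u))\<^sup>2 / 2)"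
  unfolding strongly_convex_def
proof (intro allI impI)
  fix x y and s :: real
  have "(norm ((1 - s) *\<^sub>R x + s *\<^sub>R y - u))\<^sup>2 / 2
      = (1 - s) * ((norm (x - u))\<^sup>2 / 2) + s * ((norm (y - u))\<^sup>2 / 2)
        - 1 / 2 * (s * (1 - s)) * (norm (x - y))\<^sup>2"
    by (simp add: power2_norm_eq_inner inner_simps inner_commute) (simp add: field_simps inner_commute)
  then show "(norm ((1 - s) *\<^sub>R x + s *\<^sub>R y - u))\<^sup>2 / 2
      \<le> (1 - s) * ((norm (x - u))\<^sup>2 / 2) + s * ((norm (y - u))\<^sup>2 / 2)
        - 1 / 2 * (s * (1 - s)) * (norm (x - y))\<^sup>2" by simp
qed

lemma strongly_convex_regularize:
  assumes "convex_on UNIV g" "0 \<le> \<delta>"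
  shows "strongly_convex \<delta> (regularize g \<delta> x0)"
  using strongly_convex_add[OF convex_imp_strongly_convex_0[OF assms(1)]
      strongly_convex_scale[OF strongly_convex_half_sq_dist[of x0] assms(2)]]
  by (simp add: regularize_def[abs_def])

text \<open>Minimality at \<open>m\<close> is compared with the value at \<open>(1 - s) *\<^sub>R m + s *\<^sub>R x\<close>; dividing by \<open>s\<close> and
  letting \<open>s\<close> tend to 0 gives the bound. It takes the place of the first-order optimality
  condition in all later arguments.\<close>

lemma strongly_convex_growth:
  assumes sc: "strongly_convex \<mu> h" and min: "\<And>y. h m \<le> h y"
  shows "h m + \<mu> / 2 * (norm (x - m))\<^sup>2 \<le> h x"
proof -
  let ?D = "\<mu> / 2 * (norm (x - m))\<^sup>2"
  have *: "(1 - s) * ?D \<le> h x - h m" if s: "0 < s" "s \<le> 1" for s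
  proof -
    have "h m \<le> (1 - s) * h m + s * h x - \<mu> / 2 * (s * (1 - s)) * (norm (m - x))\<^sup>2"
      using strongly_convexD[OF sc, of s m x] min[of "(1 - s) *\<^sub>R m + s *\<^sub>R x"] s by linarith
    then have "s * ((1 - s) * ?D) \<le> s * (h x - h m)"
      by (simp add: algebra_simps norm_minus_commute)
    then show ?thesis using s by simp
  qed
  have "((\<lambda>s. (1 - s) * ?D) \<longlongrightarrow> (1 - 0) * ?D) (at_right 0)"
    by (intro tendsto_intros)
  moreover have "\<forall>\<^sub>F s in at_right 0. (1 - s) * ?D \<le> h x - h m"
    unfolding eventually_at_right_field using * by (intro exI[of _ 1]) auto
  ultimately have "(1 - 0) * ?D \<le> h x - h m"
    by (intro tendsto_upperbound) auto
  then show ?thesis by simp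
qed

text \<open>A convex function is continuous, hence bounded below on the unit ball. Comparing a far point
  \<open>x\<close> with its radial projection to that ball shows that \<open>h x\<close> grows quadratically, so a minimizer
  over a large ball is a global one.\<close>

lemma strongly_convex_minimizer_exists:
  fixes h :: "'a::euclidean_space \<Rightarrow> real"
  assumes sc: "strongly_convex \<mu> h" and "0 < \<mu>"
  shows "\<exists>m. \<forall>y. h m \<le> h y"
proof -
  have "convex_on UNIV h" using strongly_convex_imp_convex[OF sc] \<open>0 < \<mu>\<close> by simp
  then have cont: "continuous_on UNIV h" by (rule convex_on_continuous[OF open_UNIV])
  obtain p where p: "\<And>y. norm y \<le> 1 \<Longrightarrow> h p \<le> h y" and p1: "norm p \<le> 1"
    using continuous_attains_inf[of "cball (0::'a) 1" h] continuous_on_subset[OF cont]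
    by (metis compact_cball cball_eq_empty mem_cball_0 not_one_less_zero subset_UNIV)
  define r where "r = 1 + 2 * (h 0 - h p) / \<mu>"
  have "h p \<le> h 0" using p by simp
  then have r1: "1 \<le> r" using \<open>0 < \<mu>\<close> by (simp add: r_def)
  have out: "h 0 \<le> h x" if "r \<le> norm x" for x
  proof -
    let ?n = "norm x"
    have n: "1 \<le> ?n" using that r1 by simp
    then have n0: "?n \<noteq> 0" by linarith
    define s where "s = 1 / ?n"
    have s: "0 \<le> s" "s \<le> 1" and sn: "s * ?n = 1" using n n0 by (auto simp: s_def divide_simps)
    have "norm ((1 - s) *\<^sub>R 0 + s *\<^sub>R x) \<le> 1" using sn s by simp
    from p[OF this] strongly_convexD[OF sc s, of 0 x]
    have "h p \<le> (1 - s) * h 0 + s * h x - \<mu> / 2 * (s * (1 - s)) * ?n\<^sup>2" by simp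
    then have "?n * h p \<le> ?n * ((1 - s) * h 0 + s * h x - \<mu> / 2 * (s * (1 - s)) * ?n\<^sup>2)"
      by (rule mult_left_mono) simp
    also have "\<dots> = ?n * h 0 - (s * ?n) * h 0 + (s * ?n) * h x
        - \<mu> / 2 * ((s * ?n) * (?n - s * ?n)) * ?n"
      by (simp add: algebra_simps power2_eq_square diff_divide_distrib)
    finally have *: "?n * (h p - h 0 + \<mu> / 2 * (?n - 1)) \<le> h x - h 0"
      unfolding sn by (simp add: algebra_simps)
    have "\<mu> / 2 * (r - 1) \<le> \<mu> / 2 * (?n - 1)" using that \<open>0 < \<mu>\<close> by simp
    then have "0 \<le> h p - h 0 + \<mu> / 2 * (?n - 1)" using \<open>0 < \<mu>\<close> by (simp add: r_def)
    then have "0 \<le> ?n * (h p - h 0 + \<mu> / 2 * (?n - 1))" by simp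
    with * show ?thesis by linarith
  qed
  obtain m where m: "\<And>y. norm y \<le> r \<Longrightarrow> h m \<le> h y"
    using continuous_attains_inf[of "cball (0::'a) r" h] continuous_on_subset[OF cont] r1
    by (metis compact_cball cball_eq_empty mem_cball_0 not_one_le_zero order_less_imp_le
        order_trans subset_UNIV)
  have "h m \<le> h 0" using m r1 by simp
  then have "h m \<le> h y" for y
    using m[of y] out[of y] by (cases "norm y \<le> r") auto
  then show ?thesis by blast
qed

lemma strongly_convex_arg_min:
  fixes h :: "'a::euclidean_space \<Rightarrow> real"
  assumes "strongly_convex \<mu> h" and "0 < \<mu>"
  shows "h (ARG_MIN h x. True) + \<mu> / 2 * (norm (x - (ARG_MIN h x. True)))\<^sup>2 \<le> h x"
proof (rule strongly_convex_growth[OF assms(1)])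
  fix y
  obtain m where "\<forall>y. h m \<le> h y" using strongly_convex_minimizer_exists[OF assms] by blast
  then show "h (ARG_MIN h x. True) \<le> h y"
    using arg_min_equality[of "\<lambda>_. True" m h] by simp
qed

text \<open>The optimality condition of the proximal point \<open>p\<close>: the vector \<open>L *\<^sub>R (u - p)\<close> is a subgradient
  of \<open>h\<close> at \<open>p\<close>. It is quadratic growth of the proximal objective with \<open>norm (x - u)\<close> expanded
  around \<open>p\<close>.\<close>

lemma prox_subgradient:
  fixes h :: "'a::euclidean_space \<Rightarrow> real"
  assumes "strongly_convex \<mu> h" "0 \<le> \<mu>" "0 < L"
  shows "h (prox (1 / L) h u) + L * ((u - prox (1 / L) h u) \<bullet> (x - prox (1 / L) h u))
      + \<mu> / 2 * (norm (x - prox (1 / L) h u))\<^sup>2 \<le> h x"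
proof -
  let ?p = "prox (1 / L) h u"
  have "strongly_convex (1 + 1 / L * \<mu>) (\<lambda>x. (norm (x - u))\<^sup>2 / 2 + 1 / L * h x)"
    using assms by (intro strongly_convex_add strongly_convex_half_sq_dist strongly_convex_scale) auto
  moreover have "0 < 1 + 1 / L * \<mu>" using assms by (simp add: add_pos_nonneg)
  ultimately have "(norm (?p - u))\<^sup>2 / 2 + 1 / L * h ?p + (1 + 1 / L * \<mu>) / 2 * (norm (x - ?p))\<^sup>2
      \<le> (norm (x - u))\<^sup>2 / 2 + 1 / L * h x"
    unfolding prox_def by (rule strongly_convex_arg_min)
  moreover have "(norm (x - u))\<^sup>2 = (norm (x - ?p))\<^sup>2 + (norm (?p - u))\<^sup>2 - 2 * ((u - ?p) \<bullet> (x - ?p))"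
    by (simp add: power2_norm_eq_inner inner_simps inner_commute)
  moreover have "(1 + 1 / L * \<mu>) / 2 * (norm (x - ?p))\<^sup>2
      = (norm (x - ?p))\<^sup>2 / 2 + 1 / L * (\<mu> / 2 * (norm (x - ?p))\<^sup>2)"
    by (simp add: algebra_simps add_divide_distrib)
  ultimately have "1 / L * h ?p + (u - ?p) \<bullet> (x - ?p) + 1 / L * (\<mu> / 2 * (norm (x - ?p))\<^sup>2)
      \<le> 1 / L * h x" by linarith
  then have "L * (1 / L * h ?p + (u - ?p) \<bullet> (x - ?p) + 1 / L * (\<mu> / 2 * (norm (x - ?p))\<^sup>2))
      \<le> L * (1 / L * h x)"
    using \<open>0 < L\<close> by (intro mult_left_mono) auto
  then show ?thesis using \<open>0 < L\<close> by (simp add: distrib_left)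
qed

section \<open>Smooth convex functions\<close>

lemma L_smooth_has_gradient:
  assumes "L_smooth L f"
  shows "(f has_derivative (\<lambda>h. h \<bullet> grad f x)) (at x)"
proof -
  obtain D where D: "GDERIV f x :> D" using assms unfolding L_smooth_def by blast
  have "D' = D" if "GDERIV f x :> D'" for D'
  proof -
    have "(\<lambda>h. h \<bullet> D') = (\<lambda>h. h \<bullet> D)"
      using that D unfolding gderiv_def by (rule has_derivative_unique)
    from fun_cong[OF this, of "D' - D"] have "(D' - D) \<bullet> (D' - D) = 0"
      by (simp add: inner_diff_right)
    then show ?thesis by simp
  qed
  then have "grad f x = D" unfolding grad_def using D by (intro the_equality)
  then show ?thesis using D by (simp add: gderiv_def)
qed

lemma L_smooth_line_derivative:
  assumes "L_smooth L f"
  shows "((\<lambda>s. f (x + s *\<^sub>R d)) has_real_derivative grad f (x + s *\<^sub>R d) \<bullet> d) (at s)"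
proof -
  have "((\<lambda>s. x + s *\<^sub>R d) has_derivative (\<lambda>s. s *\<^sub>R d)) (at s)"
    by (intro has_derivative_eq_rhs[OF has_derivative_add[OF has_derivative_const
          has_derivative_scaleR_left[OF has_derivative_ident]]]) simp
  from has_derivative_compose[OF this L_smooth_has_gradient[OF assms, of "x + s *\<^sub>R d"]]
  have "((\<lambda>s. f (x + s *\<^sub>R d)) has_derivative (\<lambda>h. h * (d \<bullet> grad f (x + s *\<^sub>R d)))) (at s)"
    by simp
  then show ?thesis
    unfolding has_field_derivative_def by (simp only: inner_commute[of d] mult_commute_abs)
qed

lemma convex_gradient_ineq:
  assumes "L_smooth L f" "convex_on UNIV f"
  shows "f x + grad f x \<bullet> (y - x) \<le> f y"
proof -
  define \<phi> where "\<phi> = (\<lambda>s. f (x + s *\<^sub>R (y - x)))"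
  have "convex_on UNIV \<phi>"
  proof (rule convex_onI)
    fix t a b :: real assume "0 < t" "t < 1"
    moreover have "x + ((1 - t) *\<^sub>R a + t *\<^sub>R b) *\<^sub>R (y - x)
        = (1 - t) *\<^sub>R (x + a *\<^sub>R (y - x)) + t *\<^sub>R (x + b *\<^sub>R (y - x))"
      by (simp add: algebra_simps)
    ultimately show "\<phi> ((1 - t) *\<^sub>R a + t *\<^sub>R b) \<le> (1 - t) * \<phi> a + t * \<phi> b"
      unfolding \<phi>_def using convex_onD[OF assms(2), of t] by simp
  qed auto
  moreover have "(\<phi> has_real_derivative grad f x \<bullet> (y - x)) (at 0)"
    using L_smooth_line_derivative[OF assms(1), of x "y - x" 0] by (simp add: \<phi>_def)
  ultimately have "grad f x \<bullet> (y - x) * (1 - 0) \<le> \<phi> 1 - \<phi> 0"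
    by (intro convex_on_imp_above_tangent[of UNIV]) auto
  then show ?thesis by (simp add: \<phi>_def)
qed

lemma descent_lemma:
  assumes "L_smooth L f"
  shows "f y \<le> f x + grad f x \<bullet> (y - x) + L / 2 * (norm (y - x))\<^sup>2"
proof -
  let ?d = "y - x"
  define \<phi> where "\<phi> = (\<lambda>s. f (x + s *\<^sub>R ?d) - s * (grad f x \<bullet> ?d) - L / 2 * s\<^sup>2 * (norm ?d)\<^sup>2)"
  have der: "(\<phi> has_real_derivative
      (grad f (x + s *\<^sub>R ?d) - grad f x) \<bullet> ?d - L * s * (norm ?d)\<^sup>2) (at s)" for s
  proof -
    have "((\<lambda>s. s * (grad f x \<bullet> ?d)) has_real_derivative grad f x \<bullet> ?d) (at s)"
      "((\<lambda>s. L / 2 * s\<^sup>2 * (norm ?d)\<^sup>2) has_real_derivative L * s * (norm ?d)\<^sup>2) (at s)"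
      by (auto intro!: derivative_eq_intros)
    from DERIV_diff[OF DERIV_diff[OF L_smooth_line_derivative[OF assms, of x ?d s] this(1)] this(2)]
    show ?thesis by (simp add: \<phi>_def inner_diff_left)
  qed
  have "\<phi> 1 \<le> \<phi> 0"
  proof (rule DERIV_nonpos_imp_nonincreasing[of 0 1 \<phi>])
    fix s :: real assume s: "0 \<le> s" "s \<le> 1"
    have "(grad f (x + s *\<^sub>R ?d) - grad f x) \<bullet> ?d \<le> norm (grad f (x + s *\<^sub>R ?d) - grad f x) * norm ?d"
      by (rule norm_cauchy_schwarz)
    also have "norm (grad f (x + s *\<^sub>R ?d) - grad f x) \<le> L * norm ((x + s *\<^sub>R ?d) - x)"
      using assms lipschitz_onD[of L UNIV "grad f" "x + s *\<^sub>R ?d" x]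
      by (simp add: L_smooth_def dist_norm)
    finally have "(grad f (x + s *\<^sub>R ?d) - grad f x) \<bullet> ?d \<le> L * s * (norm ?d)\<^sup>2"
      using s by (simp add: mult_right_mono power2_eq_square mult.assoc)
    then show "\<exists>D. (\<phi> has_real_derivative D) (at s) \<and> D \<le> 0" using der[of s] by force
  qed simp
  then show ?thesis by (simp add: \<phi>_def)
qed

text \<open>The linearization of \<open>f\<close> at \<open>x\<close> lies below \<open>f\<close> and the quadratic model at \<open>y\<close> above it.
  Comparing both at the point \<open>z\<close> where their difference is least improves the gradient inequality
  by a squared gradient difference; exchanging \<open>x\<close> and \<open>y\<close> and adding gives cocoercivity.\<close>

lemma cocoercive:
  assumes "L_smooth L f" "convex_on UNIV f" "0 < L"
  shows "(norm (grad f x - grad f y))\<^sup>2 / L \<le> (grad f x - grad f y) \<bullet> (x - y)"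
proof -
  have half: "f x + grad f x \<bullet> (y - x) + (norm (grad f x - grad f y))\<^sup>2 / (2 * L) \<le> f y" for x y
  proof -
    let ?e = "grad f y - grad f x"
    define z where "z = y - (1 / L) *\<^sub>R ?e"
    have "f x + grad f x \<bullet> (z - x) \<le> f y + grad f y \<bullet> (z - y) + L / 2 * (norm (z - y))\<^sup>2"
      using convex_gradient_ineq[OF assms(1,2), of x z] descent_lemma[OF assms(1), of z y] by linarith
    moreover have "L / 2 * (norm (z - y))\<^sup>2 = (norm ?e)\<^sup>2 / (2 * L)"
    proof -
      have "norm (z - y) = norm ?e / L" using assms(3) by (simp add: z_def)
      then show ?thesis using assms(3) by (simp add: power2_eq_square)
    qed
    moreover have "grad f y \<bullet> (z - y) - grad f x \<bullet> (z - x) = - (norm ?e)\<^sup>2 / L - grad f x \<bullet> (y - x)"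
      by (simp add: z_def power2_norm_eq_inner inner_simps algebra_simps inner_commute diff_divide_distrib
          add_divide_distrib)
    moreover have "(norm ?e)\<^sup>2 / L = (norm ?e)\<^sup>2 / (2 * L) + (norm ?e)\<^sup>2 / (2 * L)" by simp
    ultimately show ?thesis by (simp add: norm_minus_commute)
  qed
  have "(norm (grad f x - grad f y))\<^sup>2 / L
      = (norm (grad f x - grad f y))\<^sup>2 / (2 * L) + (norm (grad f y - grad f x))\<^sup>2 / (2 * L)"
    by (simp add: norm_minus_commute)
  also have "\<dots> \<le> (f y - f x - grad f x \<bullet> (y - x)) + (f x - f y - grad f y \<bullet> (x - y))"
    using half[of x y] half[of y x] by linarith
  also have "\<dots> = (grad f x - grad f y) \<bullet> (x - y)" by (simp add: inner_simps)
  finally show ?thesis .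
qed

section \<open>Proximal gradient steps\<close>

locale convex_composite =
  fixes f g :: "'a::euclidean_space \<Rightarrow> real" and L :: real
  assumes L_pos: "0 < L" and f_smooth: "L_smooth L f"
    and f_convex: "convex_on UNIV f" and g_convex: "convex_on UNIV g"
begin

abbreviation "F \<equiv> \<lambda>x. f x + g x"
abbreviation "T \<equiv> prox_grad_step f g L"
abbreviation "G \<equiv> prox_gradient f g L"

lemma convex_composite_regularize:
  assumes "0 \<le> \<delta>"
  shows "convex_composite f (regularize g \<delta> x0) L"
  using L_pos f_smooth f_convex strongly_convex_imp_convex[OF strongly_convex_regularize[OF g_convex assms]]
    assms by unfold_locales auto

lemma prox_grad_step_subgradient:
  assumes "strongly_convex \<mu> g" "0 \<le> \<mu>"
  shows "g (T y) + (L *\<^sub>R (y - T y) - grad f y) \<bullet> (w - T y) + \<mu> / 2 * (norm (w - T y))\<^sup>2 \<le> g w"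
proof -
  let ?u = "y - (1 / L) *\<^sub>R grad f y"
  have T: "T y = prox (1 / L) g ?u" by (simp add: prox_grad_step_def)
  have "L * ((?u - T y) \<bullet> (w - T y)) = (L *\<^sub>R (?u - T y)) \<bullet> (w - T y)" by simp
  also have "L *\<^sub>R (?u - T y) = L *\<^sub>R (y - T y) - grad f y"
    using L_pos by (simp add: algebra_simps)
  finally show ?thesis
    using prox_subgradient[OF assms L_pos, of ?u w] unfolding T by simp
qed

lemma prox_grad_step_subgradient_convex:
  "g (T y) + (L *\<^sub>R (y - T y) - grad f y) \<bullet> (w - T y) \<le> g w"
  using prox_grad_step_subgradient[OF convex_imp_strongly_convex_0[OF g_convex], of y w] by simp

text \<open>The sum of the gradient inequality for \<open>f\<close> at \<open>x\<close>, the descent lemma from \<open>x\<close> to \<open>T x\<close> and the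
  subgradient inequality for \<open>g\<close> at \<open>T x\<close>. For \<open>w = x\<close> it is the decrease of a proximal gradient
  step, for a minimizer \<open>w\<close> it bounds the excess of \<open>F (T x)\<close>.\<close>

lemma prox_gradient_ineq: "F (T x) + G x \<bullet> (w - x) + (norm (G x))\<^sup>2 / (2 * L) \<le> F w"
proof -
  have G: "G x = L *\<^sub>R (x - T x)" by (simp add: prox_gradient_def)
  then have x: "x = T x + (1 / L) *\<^sub>R G x" using L_pos by simp
  have "f (T x) + (grad f x \<bullet> (w - T x)) \<le> f w + L / 2 * (norm (T x - x))\<^sup>2"
    using convex_gradient_ineq[OF f_smooth f_convex, of x w] descent_lemma[OF f_smooth, of "T x" x]
    by (simp add: inner_diff_right)
  moreover have "g (T x) + G x \<bullet> (w - T x) - grad f x \<bullet> (w - T x) \<le> g w"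
    using prox_grad_step_subgradient_convex[of x w] by (simp add: G inner_diff_left)
  moreover have "L / 2 * (norm (T x - x))\<^sup>2 = (norm (G x))\<^sup>2 / (2 * L)"
    using L_pos by (simp add: G power_mult_distrib power2_eq_square norm_minus_commute)
  moreover have "G x \<bullet> (w - T x) = G x \<bullet> (w - x) + (norm (G x))\<^sup>2 / L"
  proof -
    have "G x \<bullet> (w - T x) = G x \<bullet> (w - x) + G x \<bullet> (x - T x)" by (simp add: inner_diff_right)
    also have "x - T x = (1 / L) *\<^sub>R G x" using L_pos by (simp add: G)
    finally show ?thesis by (simp add: power2_norm_eq_inner)
  qed
  moreover have "(norm (G x))\<^sup>2 / L = (norm (G x))\<^sup>2 / (2 * L) + (norm (G x))\<^sup>2 / (2 * L)" by simp
  ultimately show ?thesis by linarith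
qed

text \<open>The vector on the left is the subgradient of \<open>F\<close> at the new point \<open>T y\<close> that the step
  produces. The inequality is the progress guarantee on which acceleration rests.\<close>

lemma composite_subgradient_cocoercive:
  "(norm (L *\<^sub>R (y - T y) - grad f y + grad f (T y)))\<^sup>2 / L
     \<le> (L *\<^sub>R (y - T y) - grad f y + grad f (T y)) \<bullet> (y - T y)"
proof -
  define s d where "s = y - T y" and "d = grad f y - grad f (T y)"
  have "(norm (L *\<^sub>R s - d))\<^sup>2 = L * (L * (s \<bullet> s) - 2 * (d \<bullet> s)) + (norm d)\<^sup>2"
    by (simp add: power2_norm_eq_inner inner_simps inner_commute algebra_simps)
  then have "(norm (L *\<^sub>R s - d))\<^sup>2 / L = L * (s \<bullet> s) - 2 * (d \<bullet> s) + (norm d)\<^sup>2 / L"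
    using L_pos by (simp add: add_divide_distrib)
  moreover have "(norm d)\<^sup>2 / L \<le> d \<bullet> s"
    unfolding s_def d_def by (rule cocoercive[OF f_smooth f_convex L_pos])
  moreover have "(L *\<^sub>R s - d) \<bullet> s = L * (s \<bullet> s) - d \<bullet> s"
    by (simp add: inner_diff_left)
  ultimately have "(norm (L *\<^sub>R s - d))\<^sup>2 / L \<le> (L *\<^sub>R s - d) \<bullet> s" by linarith
  moreover have *: "L *\<^sub>R (y - T y) - grad f y + grad f (T y) = L *\<^sub>R s - d"
    by (simp add: s_def d_def)
  ultimately show ?thesis unfolding * by (simp add: s_def)
qed

text \<open>A cycle makes the proximal gradient of the regularized objective small, whereas the stopping
  test measures that of the original one. Monotonicity of the subdifferential of \<open>g\<close> between the two
  proximal points \<open>a\<close> and \<open>b\<close> bounds their distance by the gradient of the regularizing term.\<close>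

lemma prox_gradient_le_regularized:
  assumes "0 \<le> \<delta>"
  shows "norm (G x) \<le> norm (prox_gradient f (regularize g \<delta> x0) L x)
           + \<delta> * norm (prox_grad_step f (regularize g \<delta> x0) L x - x0)"
proof -
  interpret R: convex_composite f "regularize g \<delta> x0" L by (rule convex_composite_regularize[OF assms])
  define a b where "a = T x" and "b = R.T x"
  have "g a + (L *\<^sub>R (x - a) - grad f x) \<bullet> (b - a) \<le> g b"
    unfolding a_def by (rule prox_grad_step_subgradient_convex)
  moreover have "regularize g \<delta> x0 b + (L *\<^sub>R (x - b) - grad f x) \<bullet> (a - b)
      + \<delta> / 2 * (norm (a - b))\<^sup>2 \<le> regularize g \<delta> x0 a"
    unfolding b_def
    by (rule R.prox_grad_step_subgradient[OF strongly_convex_regularize[OF g_convex assms] assms])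
  moreover have "\<delta> / 2 * (norm (a - x0))\<^sup>2 = \<delta> / 2 * (norm (b - x0))\<^sup>2
      + \<delta> * ((b - x0) \<bullet> (a - b)) + \<delta> / 2 * (norm (a - b))\<^sup>2"
    by (simp add: power2_norm_eq_inner inner_simps inner_commute algebra_simps)
  moreover have "(L *\<^sub>R (x - a) - grad f x) \<bullet> (b - a) + (L *\<^sub>R (x - b) - grad f x) \<bullet> (a - b)
      = L * (norm (a - b))\<^sup>2"
    by (simp add: power2_norm_eq_inner inner_simps inner_commute algebra_simps)
  ultimately have "L * (norm (a - b))\<^sup>2 \<le> \<delta> * ((b - x0) \<bullet> (a - b))"
    unfolding regularize_def by linarith
  also have "\<dots> \<le> \<delta> * (norm (b - x0) * norm (a - b))"
    using assms by (intro mult_left_mono norm_cauchy_schwarz)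
  finally have "norm (a - b) * (L * norm (a - b)) \<le> norm (a - b) * (\<delta> * norm (b - x0))"
    by (simp add: power2_eq_square mult_ac)
  then have "L * norm (a - b) \<le> \<delta> * norm (b - x0)"
    using assms by (cases "a = b") auto
  moreover have "G x = R.G x - L *\<^sub>R (a - b)"
    by (simp add: prox_gradient_def a_def b_def algebra_simps)
  then have "norm (G x) \<le> norm (R.G x) + L * norm (a - b)"
    using norm_triangle_ineq4[of "R.G x" "L *\<^sub>R (a - b)"] L_pos by simp
  ultimately show ?thesis unfolding b_def by linarith
qed

text \<open>The error bound turns the excess \<open>h\<close> of \<open>F (T x)\<close> into a distance, and convexity bounds \<open>h\<close> by
  \<open>norm (G x)\<close> times the distance of \<open>x\<close>. The arithmetic-geometric mean inequality resolves the
  resulting implicit estimate for the distance.\<close>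

lemma infdist_le_prox_gradient:
  assumes heb: "HEB_constant F (1/2) (sublevel F e) c" and x: "x \<in> sublevel F e"
  shows "infdist x (minimizers F) \<le> (2 / L + c\<^sup>2) * norm (G x)"
proof -
  let ?D = "infdist x (minimizers F)" and ?n = "norm (G x)"
  define h where "h = F (T x) - min_value F"
  obtain p where p: "p \<in> minimizers F" using heb by (auto simp: HEB_constant_def)
  have ne: "minimizers F \<noteq> {}" and c: "0 < c" using heb by (auto simp: HEB_constant_def)
  have h0: "0 \<le> h" using p min_value_eq[OF p] by (auto simp: h_def minimizers_def)
  have n2: "0 \<le> ?n\<^sup>2 / (2 * L)" using L_pos by simp
  have "F (T x) \<le> F x" using prox_gradient_ineq[of x x] n2 by simp
  then have Tx: "T x \<in> sublevel F e" using x by (simp add: sublevel_def)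
  have "h \<le> ?n * dist x y" if "y \<in> minimizers F" for y
  proof -
    have "h \<le> - (G x \<bullet> (y - x))"
      using prox_gradient_ineq[of x y] n2 min_value_eq[OF that] by (simp add: h_def)
    also have "\<dots> \<le> ?n * norm (y - x)" using Cauchy_Schwarz_ineq2[of "G x" "y - x"] by linarith
    finally show ?thesis by (simp add: dist_norm norm_minus_commute)
  qed
  then have hD: "h \<le> ?n * ?D"
  proof (cases "?n = 0")
    case False
    then have "h / ?n \<le> dist x y" if "y \<in> minimizers F" for y
      using \<open>\<And>y. y \<in> minimizers F \<Longrightarrow> h \<le> ?n * dist x y\<close>[OF that] by (simp add: field_simps)
    then have "h / ?n \<le> ?D" unfolding infdist_notempty[OF ne] by (intro cINF_greatest[OF ne])
    then show ?thesis using False by (simp add: field_simps)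
  qed (use p in auto)
  have "?D \<le> infdist (T x) (minimizers F) + dist x (T x)" by (rule infdist_triangle)
  also have "dist x (T x) = ?n / L" using L_pos by (simp add: prox_gradient_def dist_norm)
  also have "infdist (T x) (minimizers F) \<le> c * sqrt h"
  proof -
    have "infdist (T x) (minimizers F) \<le> c * h powr (1/2)"
      using heb Tx unfolding HEB_constant_def h_def by blast
    then show ?thesis using powr_half_sqrt[OF h0] by simp
  qed
  also have "c * sqrt h \<le> (c\<^sup>2 * ?n + ?D) / 2"
  proof (rule power2_le_imp_le)
    have "(c * sqrt h)\<^sup>2 \<le> c\<^sup>2 * (?n * ?D)"
      using h0 hD by (simp add: power_mult_distrib mult_left_mono)
    also have "\<dots> \<le> ((c\<^sup>2 * ?n + ?D) / 2)\<^sup>2"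
      using zero_le_power2[of "c\<^sup>2 * ?n - ?D"] by (simp add: power2_eq_square field_simps)
    finally show "(c * sqrt h)\<^sup>2 \<le> ((c\<^sup>2 * ?n + ?D) / 2)\<^sup>2" .
  qed (simp add: infdist_nonneg)
  finally show ?thesis by (simp add: field_simps)
qed

end

section \<open>One cycle of accelerated steps\<close>

lemma next_coeff:
  assumes "0 < L" "0 \<le> \<delta>" "0 \<le> A"
  shows "0 < next_coeff L \<delta> A"
    and "(next_coeff L \<delta> A)\<^sup>2 = 2 * (1 + \<delta> * A) / L * (A + next_coeff L \<delta> A)"
proof -
  define \<rho> where "\<rho> = 2 * ((1 + \<delta> * A) / L)"
  have \<rho>: "0 < \<rho>" using assms by (simp add: \<rho>_def add_pos_nonneg)
  define r where "r = sqrt (\<rho>\<^sup>2 + 4 * \<rho> * A)"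
  define a where "a = (\<rho> + r) / 2"
  have r: "0 \<le> r" "r * r = \<rho> * \<rho> + 4 * \<rho> * A"
    using \<rho> assms by (auto simp: r_def power2_eq_square)
  have a: "0 < a" using \<rho> r by (simp add: a_def)
  have "4 * a\<^sup>2 = \<rho> * \<rho> + 2 * \<rho> * r + r * r"
    by (simp add: a_def power2_eq_square field_simps)
  then have sq: "a\<^sup>2 = \<rho> * (A + a)" unfolding r(2)
    by (simp add: a_def field_simps)
  have eq: "b\<^sup>2 / (A + b) = \<rho> \<longleftrightarrow> b\<^sup>2 = \<rho> * (A + b)" if "0 < b" for b
    using that assms by (simp add: divide_eq_eq)
  have "next_coeff L \<delta> A = a"
    unfolding next_coeff_def \<rho>_def[symmetric]
  proof (rule the_equality)
    show "0 < a \<and> a\<^sup>2 / (A + a) = \<rho>" using a sq eq[OF a] by simp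
    fix b assume b: "0 < b \<and> b\<^sup>2 / (A + b) = \<rho>"
    then have sqb: "b\<^sup>2 = \<rho> * (A + b)" using eq by blast
    have "\<rho> \<le> c" if "0 < c" "c\<^sup>2 = \<rho> * (A + c)" for c
    proof (rule ccontr)
      assume "\<not> \<rho> \<le> c"
      then have "c * c < \<rho> * c" using that by simp
      moreover have "0 \<le> \<rho> * A" using \<rho> assms by simp
      ultimately show False using that(2) by (simp add: power2_eq_square algebra_simps)
    qed
    then have "\<rho> \<le> a" "\<rho> \<le> b" using a sq b sqb by auto
    have "(a - b) * (a + b - \<rho>) = 0" using sq sqb by (simp add: power2_eq_square algebra_simps)
    then show "b = a" using \<open>\<rho> \<le> a\<close> \<open>\<rho> \<le> b\<close> \<rho> by auto
  qed
  then show "0 < next_coeff L \<delta> A"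
    "(next_coeff L \<delta> A)\<^sup>2 = 2 * (1 + \<delta> * A) / L * (A + next_coeff L \<delta> A)"
    using a sq by (auto simp: \<rho>_def)
qed

context convex_composite
begin

text \<open>Nesterov's estimate sequence. The affine function \<open>\<lambda>w. z \<bullet> w + k\<close> is the weighted sum of the
  linearizations of \<open>f\<close> at the previous iterates; their constant terms do not enter the algorithm
  and are hidden in \<open>k\<close>. The estimate function, on the right of the second inequality, is minimal
  at \<open>v\<close> with curvature \<open>1 + \<delta> * A\<close>, and the invariant is that its minimum is at least \<open>A\<close> times
  the regularized objective at \<open>x\<close>.\<close>

definition agc_invariant :: "real \<Rightarrow> 'a \<Rightarrow> real \<times> 'a \<times> 'a \<times> 'a \<Rightarrow> bool" where
  "agc_invariant \<delta> x0 = (\<lambda>(A, x, v, z). 0 \<le> A \<and> (\<exists>k. (\<forall>w. z \<bullet> w + k \<le> A * f w) \<and>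
     (\<forall>w. A * (f x + regularize g \<delta> x0 x) + (1 + \<delta> * A) / 2 * (norm (w - v))\<^sup>2
        \<le> (norm (w - x0))\<^sup>2 / 2 + z \<bullet> w + A * regularize g \<delta> x0 w + k)))"

text \<open>The new estimate function adds \<open>a\<close> times the linearization of \<open>f\<close> and \<open>a\<close> times
  the regularized \<open>g\<close>. Both are
  bounded below through the subgradient \<open>p\<close> at \<open>x'\<close>, as is the old value at \<open>x\<close>. The choice of \<open>y\<close>
  leaves \<open>A' * (p \<bullet> (y - x')) + a * (p \<bullet> (w - v))\<close> plus the curvature term, and the equation for
  \<open>a\<close> is exactly what makes the cocoercivity bound complete the square.\<close>

lemma agc_invariant_step:
  assumes \<delta>: "0 \<le> \<delta>" and inv: "agc_invariant \<delta> x0 (A, x, v, z)"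
    and a_def: "a = next_coeff L \<delta> A" and A'_def: "A' = A + a"
    and y_def: "y = (A / A') *\<^sub>R x + (a / A') *\<^sub>R v"
    and x'_def: "x' = prox_grad_step f (regularize g \<delta> x0) L y"
    and z'_def: "z' = z + a *\<^sub>R grad f x'"
    and v'_def: "v' = (ARG_MIN (\<lambda>w. (norm (w - x0))\<^sup>2 / 2 + z' \<bullet> w + A' * regularize g \<delta> x0 w) w. True)"
  shows "agc_invariant \<delta> x0 (A', x', v', z')"
proof -
  interpret R: convex_composite f "regularize g \<delta> x0" L by (rule convex_composite_regularize[OF \<delta>])
  let ?g = "regularize g \<delta> x0"
  obtain k where A: "0 \<le> A" and lower: "\<And>w. z \<bullet> w + k \<le> A * f w"
    and upper: "\<And>w. A * (f x + ?g x) + (1 + \<delta> * A) / 2 * (norm (w - v))\<^sup>2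
        \<le> (norm (w - x0))\<^sup>2 / 2 + z \<bullet> w + A * ?g w + k"
    using inv by (auto simp: agc_invariant_def)
  have a: "0 < a" and a2: "a\<^sup>2 = 2 * (1 + \<delta> * A) / L * A'"
    using next_coeff[OF L_pos \<delta> A] by (auto simp: a_def A'_def)
  have A': "0 < A'" using A a by (simp add: A'_def)
  define \<sigma> where "\<sigma> = 1 + \<delta> * A"
  have \<sigma>: "0 < \<sigma>" using \<delta> A by (simp add: \<sigma>_def add_pos_nonneg)
  define p where "p = L *\<^sub>R (y - x') - grad f y + grad f x'"
  have sub_g: "?g x' + (p - grad f x') \<bullet> (w - x') \<le> ?g w" for w
    using R.prox_grad_step_subgradient_convex[of y w] by (simp add: p_def x'_def)
  have sub_f: "f x' + grad f x' \<bullet> (w - x') \<le> f w" for w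
    by (rule convex_gradient_ineq[OF f_smooth f_convex])
  have sub_F: "f x' + ?g x' + p \<bullet> (w - x') \<le> f w + ?g w" for w
    using sub_f[of w] sub_g[of w] by (simp add: inner_diff_left)
  define k' where "k' = k + a * (f x' - grad f x' \<bullet> x')"
  have lower': "z' \<bullet> w + k' \<le> A' * f w" for w
    using lower[of w] mult_left_mono[OF sub_f[of w], of a] a
    by (simp add: z'_def k'_def A'_def inner_simps algebra_simps)
  let ?h = "\<lambda>w. (norm (w - x0))\<^sup>2 / 2 + z' \<bullet> w + A' * ?g w"
  have "convex_on UNIV (\<lambda>w. z' \<bullet> w)"
    by (rule convex_onI) (auto simp: inner_simps)
  then have "strongly_convex (1 + 0 + A' * \<delta>) ?h"
    using A' by (intro strongly_convex_add strongly_convex_half_sq_dist strongly_convex_scale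
      convex_imp_strongly_convex_0 strongly_convex_regularize[OF g_convex \<delta>]) auto
  moreover have "0 < 1 + 0 + A' * \<delta>" using A' \<delta> by (simp add: add_pos_nonneg)
  ultimately have growth: "?h v' + (1 + \<delta> * A') / 2 * (norm (w - v'))\<^sup>2 \<le> ?h w" for w
    using strongly_convex_arg_min[of "1 + 0 + A' * \<delta>" ?h w] unfolding v'_def
    by (simp add: mult.commute)
  have "A' * (f x' + ?g x') \<le> ?h w + k'" for w
  proof -
    let ?d = "w - v"
    have "A' *\<^sub>R y = A *\<^sub>R x + a *\<^sub>R v" using A' by (simp add: y_def scaleR_add_right)
    then have "A *\<^sub>R (x - x') + a *\<^sub>R (w - x') = A' *\<^sub>R (y - x') + a *\<^sub>R ?d"
      by (simp add: A'_def algebra_simps)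
    then have "A * (p \<bullet> (x - x')) + a * (p \<bullet> (w - x')) = A' * (p \<bullet> (y - x')) + a * (p \<bullet> ?d)"
      by (metis inner_add_right inner_scaleR_right)
    moreover have "A' * ((norm p)\<^sup>2 / L) \<le> A' * (p \<bullet> (y - x'))"
      using mult_left_mono[OF R.composite_subgradient_cocoercive[of y], of A'] A'
      by (simp only: p_def x'_def)
    moreover have "A' * ((norm p)\<^sup>2 / L) + a * (p \<bullet> ?d) + \<sigma> / 2 * (norm ?d)\<^sup>2
        = (norm (a *\<^sub>R p + \<sigma> *\<^sub>R ?d))\<^sup>2 / (2 * \<sigma>)"
    proof -
      have "A' / L = a\<^sup>2 / (2 * \<sigma>)" using a2 \<sigma> L_pos by (simp add: \<sigma>_def[symmetric])
      then have "A' / L * (norm p)\<^sup>2 = a\<^sup>2 / (2 * \<sigma>) * (norm p)\<^sup>2" by (rule arg_cong)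
      then have "A' * ((norm p)\<^sup>2 / L) = a\<^sup>2 * (norm p)\<^sup>2 / (2 * \<sigma>)" by simp
      moreover have "(norm (a *\<^sub>R p + \<sigma> *\<^sub>R ?d))\<^sup>2
          = a\<^sup>2 * (norm p)\<^sup>2 + 2 * \<sigma> * (a * (p \<bullet> ?d)) + 2 * \<sigma> * (\<sigma> / 2 * (norm ?d)\<^sup>2)"
        unfolding power2_norm_eq_inner
        by (simp only: inner_add_left inner_add_right inner_scaleR_left inner_scaleR_right
            inner_commute[of ?d p]) (simp add: power2_eq_square algebra_simps)
      ultimately show ?thesis using \<sigma> by (simp add: add_divide_distrib)
    qed
    moreover have "0 \<le> (norm (a *\<^sub>R p + \<sigma> *\<^sub>R ?d))\<^sup>2 / (2 * \<sigma>)" using \<sigma> by simp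
    ultimately have "0 \<le> A * (p \<bullet> (x - x')) + a * (p \<bullet> (w - x')) + \<sigma> / 2 * (norm ?d)\<^sup>2" by linarith
    moreover have "A * (f x' + ?g x' + p \<bullet> (x - x')) \<le> A * (f x + ?g x)"
      by (rule mult_left_mono[OF sub_F A])
    moreover have "a * (?g x' + (p - grad f x') \<bullet> (w - x')) \<le> a * ?g w"
      using a by (intro mult_left_mono sub_g) auto
    moreover have "A * (f x + ?g x) + \<sigma> / 2 * (norm ?d)\<^sup>2
        \<le> (norm (w - x0))\<^sup>2 / 2 + z \<bullet> w + A * ?g w + k" unfolding \<sigma>_def by (rule upper)
    ultimately show ?thesis
      by (simp add: z'_def k'_def A'_def inner_simps algebra_simps)
  qed
  from this[of v'] growth
  have upper': "A' * (f x' + ?g x') + (1 + \<delta> * A') / 2 * (norm (w - v'))\<^sup>2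
      \<le> (norm (w - x0))\<^sup>2 / 2 + z' \<bullet> w + A' * ?g w + k'" for w
    by (smt (verit))
  show ?thesis unfolding agc_invariant_def using A' lower' upper' by auto
qed

lemma agc_state_invariant:
  assumes "0 \<le> \<delta>"
  shows "agc_invariant \<delta> x0 (agc_state f g L \<delta> x0 t)"
proof (induction t)
  case 0
  show ?case by (auto simp: agc_invariant_def intro!: exI[of _ 0])
next
  case (Suc t)
  obtain A x v z where s: "agc_state f g L \<delta> x0 t = (A, x, v, z)" by (metis prod_cases4)
  from agc_invariant_step[OF assms Suc[unfolded s] refl refl refl refl refl refl]
  show ?case by (simp add: s Let_def)
qed

definition agc_weight :: "real \<Rightarrow> 'a \<Rightarrow> nat \<Rightarrow> real" where
  "agc_weight \<delta> x0 t = fst (agc_state f g L \<delta> x0 t)"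

lemma agc_weight_nonneg:
  assumes "0 \<le> \<delta>" shows "0 \<le> agc_weight \<delta> x0 t"
  using agc_state_invariant[OF assms, of x0 t] unfolding agc_invariant_def agc_weight_def
  by (auto split: prod.splits)

lemma agc_weight_Suc:
  "agc_weight \<delta> x0 (Suc t)
     = agc_weight \<delta> x0 t + next_coeff L \<delta> (agc_weight \<delta> x0 t)"
  by (simp add: agc_weight_def Let_def split: prod.splits)

lemma agc_gap:
  assumes "0 \<le> \<delta>"
  shows "agc_weight \<delta> x0 t * ((f (agc_iterate f g L \<delta> x0 t) + regularize g \<delta> x0 (agc_iterate f g L \<delta> x0 t))
      - (f w + regularize g \<delta> x0 w)) \<le> (norm (w - x0))\<^sup>2 / 2"
proof -
  obtain A x v z where s: "agc_state f g L \<delta> x0 t = (A, x, v, z)" by (metis prod_cases4)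
  obtain k where A: "0 \<le> A" and lower: "\<And>w. z \<bullet> w + k \<le> A * f w"
    and upper: "\<And>w. A * (f x + regularize g \<delta> x0 x) + (1 + \<delta> * A) / 2 * (norm (w - v))\<^sup>2
        \<le> (norm (w - x0))\<^sup>2 / 2 + z \<bullet> w + A * regularize g \<delta> x0 w + k"
    using agc_state_invariant[OF assms, of x0 t] by (auto simp: agc_invariant_def s)
  have "0 \<le> (1 + \<delta> * A) / 2 * (norm (w - v))\<^sup>2" using A assms by simp
  with upper[of w] lower[of w]
  have "A * (f x + regularize g \<delta> x0 x) \<le> (norm (w - x0))\<^sup>2 / 2 + A * f w + A * regularize g \<delta> x0 w"
    by linarith
  then show ?thesis by (simp add: agc_weight_def agc_iterate_def s algebra_simps)
qed

text \<open>The equation for \<open>a = A' - A\<close> gives \<open>a\<^sup>2 \<ge> 2 * \<delta> / L * A * A'\<close>, which forces \<open>sqrt A\<close> to grow by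
  the factor \<open>1 + sqrt (\<delta> / (2 * L))\<close>; the first step has \<open>A = 0\<close> and yields \<open>2 / L\<close>.\<close>

lemma agc_weight_growth:
  assumes "0 \<le> \<delta>"
  shows "sqrt (2 / L) * (1 + sqrt (\<delta> / (2 * L))) ^ t \<le> sqrt (agc_weight \<delta> x0 (Suc t))"
proof (induction t)
  case 0
  have "agc_weight \<delta> x0 0 = 0" by (simp add: agc_weight_def)
  moreover have "next_coeff L \<delta> 0 = 2 / L"
    using next_coeff[OF L_pos assms, of 0] L_pos by (simp add: power2_eq_square field_simps)
  ultimately show ?case using agc_weight_Suc[of \<delta> x0 0] by simp
next
  case (Suc t)
  let ?q = "sqrt (\<delta> / (2 * L))"
  define A where "A = agc_weight \<delta> x0 (Suc t)"
  define a where "a = next_coeff L \<delta> A"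
  define s s' where "s = sqrt A" and "s' = sqrt (A + a)"
  have A: "0 \<le> A" unfolding A_def by (rule agc_weight_nonneg[OF assms])
  have a: "0 < a" and a2: "a\<^sup>2 = 2 * (1 + \<delta> * A) / L * (A + a)"
    using next_coeff[OF L_pos assms A] by (auto simp: a_def)
  have s: "0 \<le> s" "s \<le> s'" "s\<^sup>2 = A" "s'\<^sup>2 = A + a" using A a by (auto simp: s_def s'_def)
  have q: "0 \<le> ?q" "?q\<^sup>2 = \<delta> / (2 * L)" using assms L_pos by auto
  have "2 * ?q * s * s' \<le> a"
  proof (rule power2_le_imp_le)
    have "(2 * ?q * s * s')\<^sup>2 = 4 * ?q\<^sup>2 * s\<^sup>2 * s'\<^sup>2" by (simp only: power_mult_distrib) simp
    also have "\<dots> = 2 * (\<delta> * A) / L * (A + a)" unfolding s q using L_pos by simp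
    also have "\<dots> \<le> 2 * (1 + \<delta> * A) / L * (A + a)"
      using A a L_pos by (intro mult_right_mono divide_right_mono) auto
    finally show "(2 * ?q * s * s')\<^sup>2 \<le> a\<^sup>2" using a2 by simp
  qed (use a in simp)
  then have *: "2 * ?q * s * s' \<le> s'\<^sup>2 - s\<^sup>2" using s by simp
  have "(1 + ?q) * s \<le> s'"
  proof (rule ccontr)
    assume "\<not> (1 + ?q) * s \<le> s'"
    then have less: "s' < (1 + ?q) * s" by simp
    then have "0 < s" using s by (cases "s = 0") auto
    have "s' * (s' - 2 * ?q * s) < s\<^sup>2"
    proof (cases "s' - 2 * ?q * s \<le> 0")
      case True
      then have "s' * (s' - 2 * ?q * s) \<le> 0" using s by (simp add: mult_nonneg_nonpos)
      then show ?thesis using \<open>0 < s\<close> by (smt (verit) zero_less_power)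
    next
      case False
      have "s' - 2 * ?q * s \<le> (1 - ?q) * s" using less by (simp add: algebra_simps)
      then have "s' * (s' - 2 * ?q * s) < (1 + ?q) * s * ((1 - ?q) * s)"
        using less False s \<open>0 < s\<close> by (intro mult_less_le_imp_less) auto
      also have "\<dots> = s\<^sup>2 - (?q * s)\<^sup>2" by (simp add: power2_eq_square algebra_simps)
      also have "\<dots> \<le> s\<^sup>2" by simp
      finally show ?thesis .
    qed
    then show False using * by (simp add: power2_eq_square algebra_simps)
  qed
  moreover have "(1 + ?q) * (sqrt (2 / L) * (1 + ?q) ^ t) \<le> (1 + ?q) * s"
    using Suc q by (intro mult_left_mono) (auto simp: s_def A_def)
  ultimately show ?case
    by (simp add: s'_def a_def A_def agc_weight_Suc[of _ _ "Suc t"] mult_ac)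
qed

lemma agc_iterate_nonincreasing:
  assumes "0 \<le> \<delta>"
  shows "F (agc_iterate f g L \<delta> x0 (Suc t)) \<le> F x0"
proof -
  let ?x = "agc_iterate f g L \<delta> x0 (Suc t)" let ?g = "regularize g \<delta> x0"
  have "0 < sqrt (2 / L) * (1 + sqrt (\<delta> / (2 * L))) ^ t"
    using L_pos assms by (intro mult_pos_pos zero_less_power add_pos_nonneg) auto
  then have "0 < agc_weight \<delta> x0 (Suc t)"
    using agc_weight_growth[OF assms, of t x0] by (smt (verit) real_sqrt_gt_0_iff)
  moreover have "agc_weight \<delta> x0 (Suc t) * ((f ?x + ?g ?x) - (f x0 + ?g x0)) \<le> 0"
    using agc_gap[OF assms, of x0 "Suc t" x0] by simp
  ultimately have "f ?x + ?g ?x \<le> f x0 + ?g x0" by (simp add: mult_le_0_iff)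
  moreover have "0 \<le> \<delta> / 2 * (norm (?x - x0))\<^sup>2" using assms by simp
  ultimately show ?thesis by (simp add: regularize_def)
qed

end

section \<open>A cycle with a large enough estimate halves the proximal gradient\<close>

text \<open>The cycle length is \<open>Y * ln X\<close> with \<open>Y = 1 / q\<close>, so that \<open>(1 + q) ^ t\<close> would be at least \<open>X\<close> if
  \<open>ln (1 + q)\<close> were \<open>q\<close>. The second-order error \<open>q\<^sup>2\<close> costs a factor of at most \<open>exp (q * ln X)\<close>,
  and since \<open>X \<le> Y\<^sup>2\<close> and \<open>q \<le> 1 / 8\<close> this is at most \<open>exp 1 \<le> 3\<close>.\<close>

lemma cycle_growth_factor:
  assumes L: "0 < L" and \<delta>: "0 < \<delta>" "\<delta> \<le> L / 32"
  shows "L / \<delta> \<le> 3 * (1 + sqrt (\<delta> / (2 * L))) ^ last_index L \<delta>"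
proof -
  define q Y X where "q = sqrt (\<delta> / (2 * L))" and "Y = sqrt (2 * L / \<delta>)"
    and "X = sqrt (L * (L + \<delta>)) / \<delta>"
  let ?t = "last_index L \<delta>"
  have qY: "q * Y = 1"
    using L \<delta> by (simp add: q_def Y_def real_sqrt_mult[symmetric])
  have Y2: "Y\<^sup>2 = 2 * L / \<delta>" using L \<delta> by (simp add: Y_def)
  have Y8: "8 \<le> Y" unfolding Y_def using \<delta> by (intro real_le_rsqrt) (simp add: field_simps)
  have q0: "0 < q" using L \<delta> by (simp add: q_def)
  have q8: "q \<le> 1 / 8" using qY mult_left_mono[OF Y8, of q] q0 by simp
  have "L \<le> sqrt (L * (L + \<delta>))"
    using L \<delta> by (intro real_le_rsqrt) (simp add: power2_eq_square algebra_simps)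
  then have XL: "L / \<delta> \<le> X" unfolding X_def using \<delta> by (intro divide_right_mono) auto
  have "32 \<le> L / \<delta>" using \<delta> by (simp add: field_simps)
  then have X1: "1 < X" using XL by linarith
  have "L * (L + \<delta>) \<le> L * (4 * L)" using L \<delta> by (intro mult_left_mono) auto
  then have "sqrt (L * (L + \<delta>)) \<le> 2 * L"
    using L by (intro real_le_lsqrt) (auto simp: power2_eq_square)
  then have XY: "X \<le> Y\<^sup>2" unfolding X_def Y2 using \<delta> by (intro divide_right_mono) auto
  have lnX: "0 < ln X" using X1 by simp
  have "ln X \<le> ln (Y\<^sup>2)" using X1 XY by (subst ln_le_cancel_iff) auto
  also have "\<dots> = 2 * ln Y" using Y8 by (simp add: ln_realpow)
  \<comment> \<open>The tangent of the logarithm at 8, the least possible value of \<open>Y\<close>.\<close>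
  also have "ln Y \<le> Y / 8 - 1 + ln 8"
    using ln_le_minus_one[of "Y / 8"] Y8 by (simp add: ln_div)
  also have "ln (8::real) = 3 * ln 2" using ln_realpow[of "2::real" 3] by simp
  finally have "ln X \<le> Y / 4 + 13 / 6" using ln2_le_25_over_36 by simp
  then have "q * ln X \<le> q * (Y / 4 + 13 / 6)" using q0 by (intro mult_left_mono) auto
  also have "\<dots> = q * Y / 4 + 13 / 6 * q" by (simp add: algebra_simps)
  finally have qlnX: "q * ln X \<le> 1" using q8 qY by linarith
  have t: "Y * ln X \<le> real ?t"
    unfolding last_index_def Y_def X_def by (rule real_nat_ceiling_ge)
  have "ln X - 1 \<le> ln X - q * ln X" using qlnX by simp
  also have "\<dots> = (q * Y) * ln X - (q * Y) * q * ln X" by (simp add: qY)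
  also have "\<dots> = Y * ln X * (q - q\<^sup>2)" by (simp add: power2_eq_square algebra_simps)
  also have "\<dots> \<le> real ?t * (q - q\<^sup>2)"
    using t q0 q8 by (intro mult_right_mono) (auto simp: power2_eq_square)
  also have "\<dots> \<le> real ?t * ln (1 + q)"
    using q0 q8 by (intro mult_left_mono ln_one_plus_pos_lower_bound) auto
  also have "\<dots> = ln ((1 + q) ^ ?t)" using q0 by (simp add: ln_realpow)
  finally have "exp (ln X - 1) \<le> exp (ln ((1 + q) ^ ?t))" by simp
  then have "X \<le> exp 1 * (1 + q) ^ ?t" using X1 q0 by (simp add: exp_diff field_simps)
  also have "\<dots> \<le> 3 * (1 + q) ^ ?t" using q0 by (intro mult_right_mono exp_le) auto
  finally show ?thesis using XL by (simp add: q_def)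
qed

lemma reg_param_pos: "0 < L \<Longrightarrow> ce \<noteq> 0 \<Longrightarrow> 0 < reg_param L ce"
  by (simp add: reg_param_def)

context convex_composite
begin

text \<open>Let \<open>D\<close> be the distance of the starting point to the minimizers of \<open>F\<close>. The minimizer \<open>m\<close> of
  the regularized objective is no farther than \<open>D\<close>, so the estimate sequence bounds the regularized
  gap by \<open>D\<^sup>2 / (2 * A)\<close>. This controls the regularized proximal gradient and the distance to \<open>m\<close>,
  and in total \<open>norm (G x) \<le> D * ((sqrt L + sqrt \<delta>) / sqrt A) + \<delta> * D\<close>. By the length of the cycle
  this is at most \<open>4 * \<delta> * D\<close>, and by the error bound and the choice of \<open>\<delta>\<close> the quantity \<open>\<delta> * D\<close> is
  at most an eighth of the initial proximal gradient.\<close>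

lemma cycle_halves_prox_gradient:
  assumes heb: "HEB_constant F (1/2) (sublevel F e) c" and x0: "x0 \<in> sublevel F e"
    and ce: "c \<le> ce" and \<delta>_def: "\<delta> = reg_param L ce"
  shows "norm (G (agc_iterate f g L \<delta> x0 (Suc (last_index L \<delta>)))) \<le> norm (G x0) / 2"
proof -
  have c: "0 < c" and ne: "minimizers F \<noteq> {}" using heb by (auto simp: HEB_constant_def)
  have \<delta>: "0 < \<delta>" "\<delta> \<le> L / 32" "\<delta> \<le> 1 / (32 * ce\<^sup>2)"
    using reg_param_pos[OF L_pos, of ce] c ce by (auto simp: \<delta>_def reg_param_def)
  interpret R: convex_composite f "regularize g \<delta> x0" L
    using \<delta> by (intro convex_composite_regularize) auto
  let ?t = "last_index L \<delta>"
  define x where "x = agc_iterate f g L \<delta> x0 (Suc ?t)"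
  define A where "A = agc_weight \<delta> x0 (Suc ?t)"
  define D where "D = infdist x0 (minimizers F)"
  have scF: "strongly_convex \<delta> R.F"
    using strongly_convex_add[OF convex_imp_strongly_convex_0[OF f_convex]
        strongly_convex_regularize[OF g_convex, of \<delta> x0]] \<delta> by simp
  then obtain m where m: "\<And>w. R.F m \<le> R.F w"
    using strongly_convex_minimizer_exists \<delta>(1) by blast
  have D0: "0 \<le> D" by (simp add: D_def infdist_nonneg)
  have mD: "norm (m - x0) \<le> D"
  proof -
    have "norm (m - x0) \<le> dist x0 p" if p: "p \<in> minimizers F" for p
    proof -
      have "\<delta> / 2 * (norm (m - x0))\<^sup>2 \<le> \<delta> / 2 * (norm (p - x0))\<^sup>2"
        using m[of p] p by (auto simp: regularize_def minimizers_def dest!: spec[of _ m])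
      then have "(norm (m - x0))\<^sup>2 \<le> (norm (p - x0))\<^sup>2" using \<delta> by simp
      then have "norm (m - x0) \<le> norm (p - x0)" by (rule power2_le_imp_le) simp
      then show ?thesis by (simp add: dist_norm norm_minus_commute)
    qed
    then show ?thesis unfolding D_def infdist_notempty[OF ne] by (intro cINF_greatest[OF ne])
  qed
  let ?E = "(1 + sqrt (\<delta> / (2 * L))) ^ ?t"
  have E: "L / \<delta> \<le> 3 * ?E" by (rule cycle_growth_factor[OF L_pos \<delta>(1,2)])
  have sA: "sqrt (2 / L) * ?E \<le> sqrt A"
    unfolding A_def using \<delta> by (intro agc_weight_growth) auto
  have E0: "0 < ?E" using \<delta> L_pos by (intro zero_less_power add_pos_nonneg) auto
  then have "0 < sqrt (2 / L) * ?E" using L_pos by simp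
  then have sA0: "0 < sqrt A" using sA by linarith
  then have A0: "0 < A" by simp
  have gap: "R.F x - R.F m \<le> D\<^sup>2 / (2 * A)"
  proof -
    have "A * (R.F x - R.F m) \<le> (norm (m - x0))\<^sup>2 / 2"
      unfolding A_def x_def using \<delta> by (intro agc_gap) auto
    also have "\<dots> \<le> D\<^sup>2 / 2" using mD by (intro divide_right_mono power_mono) auto
    finally show ?thesis using A0 by (simp add: field_simps)
  qed
  have ineq: "R.F (R.T x) + (norm (R.G x))\<^sup>2 / (2 * L) \<le> R.F x"
    using R.prox_gradient_ineq[of x x] by simp
  have Gb: "norm (R.G x) \<le> D * sqrt L / sqrt A"
  proof (rule power2_le_imp_le)
    have "(norm (R.G x))\<^sup>2 / (2 * L) \<le> D\<^sup>2 / (2 * A)" using ineq gap m[of "R.T x"] by linarith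
    then have "(norm (R.G x))\<^sup>2 \<le> D\<^sup>2 * L / A" using L_pos A0 by (simp add: field_simps)
    also have "\<dots> = (D * sqrt L / sqrt A)\<^sup>2"
      using L_pos A0 by (simp add: power_mult_distrib power_divide)
    finally show "(norm (R.G x))\<^sup>2 \<le> (D * sqrt L / sqrt A)\<^sup>2" .
  qed (use D0 L_pos A0 in simp)
  have Tb: "norm (R.T x - m) \<le> D / (sqrt \<delta> * sqrt A)"
  proof (rule power2_le_imp_le)
    have "0 \<le> (norm (R.G x))\<^sup>2 / (2 * L)" using L_pos by simp
    then have "\<delta> / 2 * (norm (R.T x - m))\<^sup>2 \<le> D\<^sup>2 / (2 * A)"
      using strongly_convex_growth[OF scF m, of "R.T x"] ineq gap by linarith
    then have "(norm (R.T x - m))\<^sup>2 \<le> D\<^sup>2 / (\<delta> * A)" using \<delta> A0 by (simp add: field_simps)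
    also have "\<dots> = (D / (sqrt \<delta> * sqrt A))\<^sup>2"
      using \<delta> A0 by (simp add: power_mult_distrib power_divide)
    finally show "(norm (R.T x - m))\<^sup>2 \<le> (D / (sqrt \<delta> * sqrt A))\<^sup>2" .
  qed (use D0 \<delta> A0 in simp)
  have "\<delta> * norm (R.T x - x0) \<le> \<delta> * (D / (sqrt \<delta> * sqrt A) + D)"
    using norm_triangle_ineq[of "R.T x - m" "m - x0"] Tb mD \<delta> by (intro mult_left_mono) auto
  also have "\<dots> = D * sqrt \<delta> / sqrt A + \<delta> * D"
  proof -
    have "\<delta> * (D / (sqrt \<delta> * sqrt A) + D) = D * (\<delta> / sqrt \<delta>) / sqrt A + \<delta> * D"
      by (simp add: distrib_left)
    then show ?thesis using \<delta> by (simp only: real_div_sqrt)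
  qed
  finally have "norm (G x) \<le> D * sqrt L / sqrt A + (D * sqrt \<delta> / sqrt A + \<delta> * D)"
    using prox_gradient_le_regularized[of \<delta> x x0] Gb \<delta> by linarith
  also have "\<dots> = D * ((sqrt L + sqrt \<delta>) / sqrt A) + \<delta> * D"
    by (simp add: add_divide_distrib algebra_simps)
  also have "(sqrt L + sqrt \<delta>) / sqrt A \<le> 3 * \<delta>"
  proof -
    have "sqrt \<delta> \<le> sqrt (L / 16)" using \<delta> L_pos by (intro real_sqrt_le_mono) auto
    also have "sqrt (L / 16) = sqrt L / 4" using real_sqrt_abs[of 4] by (simp add: real_sqrt_divide)
    finally have "sqrt L + sqrt \<delta> \<le> 5 / 4 * sqrt L" by simp
    moreover have "5 / 4 \<le> sqrt 2" by (rule real_le_rsqrt) (simp add: power2_eq_square)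
    then have "5 / 4 * sqrt L \<le> sqrt 2 * sqrt L" using L_pos by (intro mult_right_mono) auto
    moreover have "sqrt 2 * sqrt L = sqrt (2 / L) * L"
      using L_pos real_sqrt_mult_self[of L] by (simp add: real_sqrt_divide field_simps)
    moreover have "sqrt (2 / L) * L \<le> sqrt (2 / L) * (3 * \<delta> * ?E)"
      using E \<delta> L_pos by (intro mult_left_mono) (auto simp: field_simps)
    moreover have "sqrt (2 / L) * (3 * \<delta> * ?E) \<le> 3 * \<delta> * sqrt A"
      using mult_left_mono[OF sA, of "3 * \<delta>"] \<delta> by (simp add: mult_ac)
    ultimately show ?thesis using sA0 by (simp add: divide_le_eq)
  qed
  also have "D * (3 * \<delta>) + \<delta> * D = 4 * (\<delta> * D)" by simp
  also have "\<delta> * D \<le> \<delta> * ((2 / L + c\<^sup>2) * norm (G x0))"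
    unfolding D_def using infdist_le_prox_gradient[OF heb x0] \<delta> by (intro mult_left_mono) auto
  also have "\<dots> = (\<delta> * (2 / L + c\<^sup>2)) * norm (G x0)" by simp
  also have "\<delta> * (2 / L + c\<^sup>2) \<le> 1 / 8"
  proof -
    have "\<delta> * (2 / L) \<le> 1 / 16" using \<delta> L_pos by (simp add: field_simps)
    moreover have "\<delta> * c\<^sup>2 \<le> 1 / (32 * ce\<^sup>2) * ce\<^sup>2"
      using \<delta> c ce by (intro mult_mono power_mono) auto
    moreover have "\<dots> = 1 / 32" using c ce by simp
    ultimately show ?thesis by (simp add: distrib_left)
  qed
  finally show ?thesis using D0 by (simp add: x_def mult_left_mono mult_right_mono)
qed

end

section \<open>Counting iterations\<close>

text \<open>Here \<open>M\<close> bounds the condition number for the estimate \<open>ce\<close>, so that \<open>L / \<delta> \<le> 32 * M\<close>: the square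
  root in the cycle length is at most \<open>8 * sqrt M\<close> and the argument of the logarithm at most
  \<open>64 * M\<close>. The factor 36 absorbs \<open>ln 64\<close> and the rounding.\<close>

lemma cycle_length_bound:
  assumes L: "0 < L" and ce: "0 < ce" and M: "1 \<le> M" "L * ce\<^sup>2 \<le> M"
  shows "real (Suc (last_index L (reg_param L ce))) \<le> 36 * (sqrt M * (1 + ln M))"
proof -
  define \<delta> X where "\<delta> = reg_param L ce" and "X = sqrt (L * (L + \<delta>)) / \<delta>"
  have \<delta>: "0 < \<delta>" "\<delta> \<le> L / 32" using reg_param_pos[OF L, of ce] ce by (auto simp: \<delta>_def reg_param_def)
  have "L \<le> 32 * M * \<delta>"
  proof (cases "L / 32 \<le> 1 / (32 * ce\<^sup>2)")
    case True
    have "L * 1 \<le> L * M" using L M by (intro mult_left_mono) auto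
    then show ?thesis using True by (simp add: \<delta>_def reg_param_def mult.commute)
  next
    case False
    have "L = L * ce\<^sup>2 / ce\<^sup>2" using ce by simp
    also have "\<dots> \<le> M / ce\<^sup>2" using M by (intro divide_right_mono) auto
    finally show ?thesis using False by (simp add: \<delta>_def reg_param_def)
  qed
  then have LM: "L / \<delta> \<le> 32 * M" using \<delta> by (simp add: divide_le_eq)
  have sq: "sqrt (2 * L / \<delta>) \<le> 8 * sqrt M"
    using LM M L \<delta> by (intro real_le_lsqrt) (auto simp: power_mult_distrib)
  have "L * (L + \<delta>) \<le> L * (4 * L)" using L \<delta> by (intro mult_left_mono) auto
  then have "sqrt (L * (L + \<delta>)) \<le> 2 * L"
    using L by (intro real_le_lsqrt) (auto simp: power2_eq_square)
  then have "X \<le> 2 * L / \<delta>" unfolding X_def using \<delta> by (intro divide_right_mono) auto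
  then have XM: "X \<le> 64 * M" using LM by simp
  have "\<delta> \<le> sqrt (L * (L + \<delta>))"
    using L \<delta> by (intro real_le_rsqrt) (auto simp: power2_eq_square intro!: mult_mono)
  then have X1: "1 \<le> X" using \<delta> by (simp add: X_def)
  have "ln X \<le> ln (64 * M)" using XM X1 M by (subst ln_le_cancel_iff) auto
  also have "\<dots> = ln 64 + ln M" using M by (simp add: ln_mult)
  also have "ln (64::real) = 6 * ln 2" using ln_realpow[of "2::real" 6] by simp
  finally have lnX: "ln X \<le> 25 / 6 + ln M" using ln2_le_25_over_36 by simp
  have lnM: "0 \<le> ln M" and sM: "1 \<le> sqrt M" using M by auto
  have "real (last_index L \<delta>) \<le> sqrt (2 * L / \<delta>) * ln X + 1"
  proof -
    have "0 \<le> sqrt (2 * L / \<delta>) * ln X" using X1 L \<delta> by simp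
    then show ?thesis unfolding last_index_def X_def by linarith
  qed
  also have "\<dots> \<le> 8 * sqrt M * (25 / 6 + ln M) + 1"
    using sq lnX X1 lnM M by (intro add_right_mono mult_mono) auto
  finally have "real (Suc (last_index L \<delta>)) \<le> 8 * sqrt M * (25 / 6 + ln M) + 2 * sqrt M"
    unfolding of_nat_Suc using sM by linarith
  also have "\<dots> = sqrt M * (106 / 3 + 8 * ln M)" by (simp add: algebra_simps)
  also have "\<dots> \<le> sqrt M * (36 * (1 + ln M))" using lnM sM by (intro mult_left_mono) auto
  finally show ?thesis by (simp add: \<delta>_def mult_ac)
qed

context convex_composite
begin

context
  fixes e c \<gamma> :: real
  assumes heb: "HEB_constant F (1/2) (sublevel F e) c" and \<gamma>: "1 < \<gamma>"
begin

lemma cycle_success: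
  assumes "x \<in> sublevel F e" "norm (G x) \<le> \<epsilon>" "c \<le> ce"
  shows "\<exists>t \<le> last_index L (reg_param L ce).
           norm (G (agc_iterate f g L (reg_param L ce) x (Suc t))) \<le> \<epsilon> / 2"
  using cycle_halves_prox_gradient[OF heb assms(1,3) refl] assms(2)
  by (intro exI[of _ "last_index L (reg_param L ce)"]) auto

lemma stage_if_cycle_succeeds:
  assumes "\<exists>t \<le> last_index L (reg_param L ce).
             norm (G (agc_iterate f g L (reg_param L ce) x (Suc t))) \<le> \<epsilon> / 2"
  shows "\<exists>N x'. stage f g L \<gamma> x \<epsilon> ce N x' ce"
proof -
  let ?P = "\<lambda>t. norm (G (agc_iterate f g L (reg_param L ce) x (Suc t))) \<le> \<epsilon> / 2"
  obtain t where t: "t \<le> last_index L (reg_param L ce)" "?P t" using assms by blast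
  have "(LEAST t. ?P t) \<le> last_index L (reg_param L ce)"
    using Least_le[of ?P t] t by simp
  moreover have "?P (LEAST t. ?P t)" using t(2) by (rule LeastI)
  moreover have "\<not> ?P s" if "s < (LEAST t. ?P t)" for s using that by (rule not_less_Least)
  ultimately show ?thesis by (blast intro: stage.success[OF refl])
qed

text \<open>Failing cycles multiply the estimate by \<open>\<gamma>\<close>, and no cycle fails once it has reached \<open>c\<close>.\<close>

lemma stage_terminates:
  assumes x: "x \<in> sublevel F e" "norm (G x) \<le> \<epsilon>" and ce: "0 < ce"
  shows "\<exists>N x' ce'. stage f g L \<gamma> x \<epsilon> ce N x' ce'"
proof -
  obtain n where "c / ce < \<gamma> ^ n" using real_arch_pow[OF \<gamma>] by blast
  then have "c \<le> \<gamma> ^ n * ce" using ce by (simp add: field_simps)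
  then show ?thesis using ce
  proof (induction n arbitrary: ce)
    case (0 ce)
    then have "c \<le> ce" by simp
    from stage_if_cycle_succeeds[OF cycle_success[OF x this]] show ?case by blast
  next
    case (Suc n ce)
    show ?case
    proof (cases "\<exists>t \<le> last_index L (reg_param L ce).
           norm (G (agc_iterate f g L (reg_param L ce) x (Suc t))) \<le> \<epsilon> / 2")
      case True
      then show ?thesis using stage_if_cycle_succeeds by blast
    next
      case False
      have "\<exists>N x' ce'. stage f g L \<gamma> x \<epsilon> (\<gamma> * ce) N x' ce'"
        using Suc.prems \<gamma> by (intro Suc.IH) (auto simp: mult_ac)
      then obtain N x' ce' where "stage f g L \<gamma> x \<epsilon> (\<gamma> * ce) N x' ce'" by blast
      then have "stage f g L \<gamma> x \<epsilon> ce (Suc (last_index L (reg_param L ce)) + N) x' ce'"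
        using False by (intro stage.failure[OF refl]) auto
      then show ?thesis by blast
    qed
  qed
qed

text \<open>The exponent \<open>i\<close> counts the failing cycles of the stage. A cycle fails only with an estimate
  below \<open>c\<close>, so the estimate never exceeds \<open>\<gamma> * c\<close>; this bounds the length of every cycle, and
  over the whole run the number of failures.\<close>

lemma stage_bound:
  assumes "stage f g L \<gamma> x \<epsilon> ce N x' ce'"
    and x: "x \<in> sublevel F e" "norm (G x) \<le> \<epsilon>"
    and "0 < ce" "ce \<le> \<gamma> * c" and M: "1 \<le> M" "L * (\<gamma> * c)\<^sup>2 \<le> M"
  shows "x' \<in> sublevel F e \<and> norm (G x') \<le> \<epsilon> / 2 \<and>
    (\<exists>i. ce' = \<gamma> ^ i * ce \<and> ce' \<le> \<gamma> * c \<and> real N \<le> (real i + 1) * (36 * (sqrt M * (1 + ln M))))"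
  using assms(1,4,5)
proof (induction rule: stage.induct)
  case (success \<delta> ce t)
  have len: "real (Suc (last_index L (reg_param L ce))) \<le> 36 * (sqrt M * (1 + ln M))"
  proof (rule cycle_length_bound[OF L_pos \<open>0 < ce\<close> M(1)])
    have "L * ce\<^sup>2 \<le> L * (\<gamma> * c)\<^sup>2"
      using success.prems L_pos by (intro mult_left_mono power_mono) auto
    then show "L * ce\<^sup>2 \<le> M" using M(2) by simp
  qed
  have "0 < \<delta>" using success reg_param_pos[OF L_pos, of ce] by simp
  then have "F (agc_iterate f g L \<delta> x (Suc t)) \<le> F x"
    by (intro agc_iterate_nonincreasing) simp
  then have "agc_iterate f g L \<delta> x (Suc t) \<in> sublevel F e"
    using x(1) by (simp add: sublevel_def)
  moreover have "real (Suc t) \<le> 36 * (sqrt M * (1 + ln M))" using len success.hyps by simp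
  ultimately show ?case using success by (intro conjI exI[of _ 0]) auto
next
  case (failure \<delta> ce N x' ce')
  have len: "real (Suc (last_index L (reg_param L ce))) \<le> 36 * (sqrt M * (1 + ln M))"
  proof (rule cycle_length_bound[OF L_pos \<open>0 < ce\<close> M(1)])
    have "L * ce\<^sup>2 \<le> L * (\<gamma> * c)\<^sup>2"
      using failure.prems L_pos by (intro mult_left_mono power_mono) auto
    then show "L * ce\<^sup>2 \<le> M" using M(2) by simp
  qed
  have "ce < c"
  proof (rule ccontr)
    assume "\<not> ce < c"
    then have "c \<le> ce" by simp
    from cycle_success[OF x this] show False using failure.hyps by auto
  qed
  then have "0 < \<gamma> * ce" "\<gamma> * ce \<le> \<gamma> * c" using failure.prems \<gamma> by auto
  from failure.IH[OF this] obtain i where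
    IH: "x' \<in> sublevel F e" "norm (G x') \<le> \<epsilon> / 2" "ce' = \<gamma> ^ i * (\<gamma> * ce)" "ce' \<le> \<gamma> * c"
      "real N \<le> (real i + 1) * (36 * (sqrt M * (1 + ln M)))" by blast
  moreover have "real (Suc (last_index L \<delta>) + N)
      \<le> (real (Suc i) + 1) * (36 * (sqrt M * (1 + ln M)))"
    using IH(5) len failure.hyps by (simp add: algebra_simps)
  ultimately show ?case by (intro conjI exI[of _ "Suc i"]) auto
qed

context
  fixes x0 :: 'a and c0 M :: real
  assumes x0: "x0 \<in> sublevel F e" and c0: "0 < c0" "c0 \<le> c"
    and M: "1 \<le> M" "L * (\<gamma> * c)\<^sup>2 \<le> M"
begin

lemma adaAGC_bound:
  assumes "adaAGC f g L \<gamma> c0 x0 k N x \<epsilon> ce"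
  shows "x \<in> sublevel F e \<and> norm (G x) \<le> \<epsilon> \<and> \<epsilon> = norm (G x0) / 2 ^ k \<and>
    (\<exists>i. ce = \<gamma> ^ i * c0 \<and> ce \<le> \<gamma> * c \<and> real N \<le> (real i + real k) * (36 * (sqrt M * (1 + ln M))))"
  using assms
proof (induction rule: adaAGC.induct)
  case start
  have "c0 \<le> 1 * c" using c0 by simp
  also have "\<dots> \<le> \<gamma> * c" using \<gamma> c0 by (intro mult_right_mono) auto
  finally show ?case using x0 by (intro conjI exI[of _ 0]) auto
next
  case (step k N x \<epsilon> ce N' x' ce')
  then obtain i where i: "ce = \<gamma> ^ i * c0" "ce \<le> \<gamma> * c"
      "real N \<le> (real i + real k) * (36 * (sqrt M * (1 + ln M)))"
    and x: "x \<in> sublevel F e" "norm (G x) \<le> \<epsilon>" "\<epsilon> = norm (G x0) / 2 ^ k" by blast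
  have "0 < ce" using i(1) \<gamma> c0 by simp
  from stage_bound[OF step.hyps(2) x(1,2) this i(2) M] obtain j where
    j: "x' \<in> sublevel F e" "norm (G x') \<le> \<epsilon> / 2" "ce' = \<gamma> ^ j * ce" "ce' \<le> \<gamma> * c"
      "real N' \<le> (real j + 1) * (36 * (sqrt M * (1 + ln M)))" by blast
  have "real (N + N') \<le> (real (j + i) + real (Suc k)) * (36 * (sqrt M * (1 + ln M)))"
    using i(3) j(5) by (simp add: algebra_simps)
  then show ?case using i j x by (intro conjI exI[of _ "j + i"]) (auto simp: power_add)
qed

lemma adaAGC_terminates: "\<exists>N x \<epsilon> ce. adaAGC f g L \<gamma> c0 x0 k N x \<epsilon> ce"
proof (induction k)
  case 0
  show ?case using adaAGC.start by blast
next
  case (Suc k)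
  then obtain N x \<epsilon> ce where *: "adaAGC f g L \<gamma> c0 x0 k N x \<epsilon> ce" by blast
  from adaAGC_bound[OF this] obtain i where
    x: "x \<in> sublevel F e" "norm (G x) \<le> \<epsilon>" and "ce = \<gamma> ^ i * c0" by blast
  then have "0 < ce" using \<gamma> c0 by simp
  from stage_terminates[OF x this] * show ?case using adaAGC.step by blast
qed

end

end

end

lemma stage_count_bound:
  assumes "1 \<le> r"
  shows "real (nat \<lceil>log 2 r\<rceil>) \<le> 5 / 2 * max 1 (ln r)" and "r \<le> 2 ^ nat \<lceil>log 2 r\<rceil>"
proof -
  have lr: "0 \<le> ln r" using assms by simp
  have "0 \<le> log 2 r" using assms by (simp add: zero_le_log_cancel_iff)
  then have "real (nat \<lceil>log 2 r\<rceil>) \<le> log 2 r + 1" by linarith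
  also have "log 2 r \<le> 3 / 2 * ln r"
  proof -
    have "2 / 3 * ln r \<le> ln 2 * ln r" using ln2_ge_two_thirds lr by (intro mult_right_mono) auto
    then show ?thesis by (simp add: log_def divide_le_eq mult_ac)
  qed
  finally show "real (nat \<lceil>log 2 r\<rceil>) \<le> 5 / 2 * max 1 (ln r)" by (simp add: max_def split: if_splits)
  have "r = 2 powr log 2 r" using assms by simp
  also have "\<dots> \<le> 2 powr real (nat \<lceil>log 2 r\<rceil>)" by (intro powr_mono real_nat_ceiling_ge) auto
  finally show "r \<le> 2 ^ nat \<lceil>log 2 r\<rceil>" by (simp add: powr_realpow)
qed

text \<open>A run has one successful cycle in each of its \<open>K \<le> 5 / 2 * max 1 (ln r)\<close> stages, and at most
  \<open>1 + log \<gamma> (c / c0)\<close> failing ones. With cycles of length at most \<open>36 * sqrt M * (1 + ln M)\<close> for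
  \<open>M = \<gamma>\<^sup>2 * \<kappa>\<close> this gives the constant \<open>36 * 7 / 2 = 126\<close>.\<close>

theorem adaAGC_linear_convergence_convex:
  fixes f g :: "'a::euclidean_space \<Rightarrow> real"
  assumes "convex_on UNIV f" "convex_on UNIV g"
  shows "adaAGC_linear_convergence f g"
  unfolding adaAGC_linear_convergence_def Let_def
proof (intro allI impI, elim conjE)
  fix L :: real and x0 and e c c0 \<gamma> \<epsilon> :: real
  let ?F = "\<lambda>x. f x + g x" and ?G = "prox_gradient f g L"
  let ?r = "norm (?G x0) / \<epsilon>"
  let ?K = "nat \<lceil>log 2 ?r\<rceil>"
  assume L: "0 < L" "L_smooth L f" and x0: "?F x0 - min_value ?F \<le> e"
    and heb: "HEB_constant ?F (1/2) (sublevel ?F e) c"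
    and c0: "0 < c0" "c0 \<le> c" and \<gamma>: "1 < \<gamma>" and \<epsilon>: "0 < \<epsilon>" "\<epsilon> \<le> norm (?G x0)"
  interpret convex_composite f g L using L assms by unfold_locales
  have x0: "x0 \<in> sublevel ?F e" using x0 by (simp add: sublevel_def)
  define \<kappa> M where "\<kappa> = max 1 (L * c\<^sup>2)" and "M = \<gamma>\<^sup>2 * \<kappa>"
  have \<kappa>: "1 \<le> \<kappa>" "L * c\<^sup>2 \<le> \<kappa>" by (auto simp: \<kappa>_def)
  have "1 * 1 \<le> \<gamma>\<^sup>2 * \<kappa>" using \<gamma> \<kappa> by (intro mult_mono) (auto simp: one_le_power)
  then have M1: "1 \<le> M" by (simp add: M_def)
  have M2: "L * (\<gamma> * c)\<^sup>2 \<le> M"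
    using mult_left_mono[OF \<kappa>(2), of "\<gamma>\<^sup>2"] by (simp add: M_def power_mult_distrib mult_ac)
  have r: "1 \<le> ?r" using \<epsilon> by simp
  have "norm (?G x) \<le> \<epsilon> \<and> real N \<le> iteration_bound L c c0 \<gamma> ?r"
    if run: "adaAGC f g L \<gamma> c0 x0 ?K N x e' ce" for N x e' ce
  proof
    from adaAGC_bound[OF heb \<gamma> x0 c0 M1 M2 run] obtain i where
      x: "norm (?G x) \<le> norm (?G x0) / 2 ^ ?K" and i: "\<gamma> ^ i * c0 \<le> \<gamma> * c"
      and N: "real N \<le> (real i + real ?K) * (36 * (sqrt M * (1 + ln M)))" by blast
    have "norm (?G x0) / 2 ^ ?K \<le> \<epsilon>"
      using stage_count_bound(2)[OF r] \<epsilon> by (simp add: field_simps)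
    with x show "norm (?G x) \<le> \<epsilon>" by simp
    define l m where "l = log \<gamma> (c / c0)" and "m = max 1 (ln ?r)"
    have l: "0 \<le> l" unfolding l_def using c0 \<gamma> by (simp add: zero_le_log_cancel_iff)
    have m: "1 \<le> m" by (simp add: m_def)
    have "real i \<le> 1 + l"
    proof -
      have "\<gamma> ^ i \<le> \<gamma> * (c / c0)" using i c0 by (simp add: field_simps)
      then have "log \<gamma> (\<gamma> ^ i) \<le> log \<gamma> (\<gamma> * (c / c0))"
        using \<gamma> c0 by (subst log_le_cancel_iff) auto
      also have "\<dots> = log \<gamma> \<gamma> + log \<gamma> (c / c0)"
        using \<gamma> c0 by (simp add: log_def ln_mult ln_div add_divide_distrib diff_divide_distrib)
      finally show ?thesis using \<gamma> by (simp add: l_def log_nat_power)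
    qed
    moreover have "real ?K \<le> 5 / 2 * m" unfolding m_def by (rule stage_count_bound(1)[OF r])
    moreover have "1 + l \<le> (1 + l) * m" using mult_left_mono[OF m, of "1 + l"] l by simp
    moreover have "5 / 2 * m \<le> 5 / 2 * ((1 + l) * m)" using l m by simp
    ultimately have count: "real i + real ?K \<le> 7 / 2 * ((1 + l) * m)" by linarith
    have B0: "0 \<le> sqrt M * (1 + ln M)" using M1 by simp
    have "real N \<le> 7 / 2 * ((1 + l) * m) * (36 * (sqrt M * (1 + ln M)))"
      using N mult_right_mono[OF count, of "36 * (sqrt M * (1 + ln M))"] B0 by linarith
    also have "\<dots> = 126 * ((1 + l) * m * (sqrt M * (1 + ln M)))" by simp
    also have "\<dots> \<le> 128 * ((1 + l) * m * (sqrt M * (1 + ln M)))"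
      using l m B0 by (intro mult_right_mono) auto
    also have "sqrt M = \<gamma> * sqrt \<kappa>" using \<gamma> by (simp add: M_def real_sqrt_mult)
    finally show "real N \<le> iteration_bound L c c0 \<gamma> ?r"
      unfolding iteration_bound_def Let_def \<kappa>_def[symmetric] M_def[symmetric] l_def[symmetric]
        m_def[symmetric] by (simp only: mult_ac)
  qed
  then show "(\<exists>N x e ce. adaAGC f g L \<gamma> c0 x0 ?K N x e ce) \<and>
      (\<forall>N x e ce. adaAGC f g L \<gamma> c0 x0 ?K N x e ce \<longrightarrow>
         norm (?G x) \<le> \<epsilon> \<and> real N \<le> iteration_bound L c c0 \<gamma> ?r)"
    using adaAGC_terminates[OF heb \<gamma> x0 c0 M1 M2] by blast
qed

section \<open>Regularized empirical losses\<close>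

lemma avg_loss_convex_pcq:
  fixes a :: "nat \<Rightarrow> real ^ 'd"
  assumes "\<And>y. admissible_loss (\<lambda>z. l z y)"
  shows "convex_on UNIV (avg_loss l n a b)" and "piecewise_convex_quadratic (avg_loss l n a b)"
    and "0 \<le> avg_loss l n a b x"
proof -
  have "convex_on UNIV (\<lambda>x. l (x \<bullet> a i) (b i))"
    "piecewise_convex_quadratic (\<lambda>x. l (x \<bullet> a i) (b i))" for i
    using assms[of "b i"] convex_on_compose_inner[of "\<lambda>z. l z (b i)" "a i"]
      piecewise_convex_quadratic_compose_inner[of "\<lambda>z. l z (b i)" "a i"]
    by (simp_all add: admissible_loss_def)
  then show "convex_on UNIV (avg_loss l n a b)" "piecewise_convex_quadratic (avg_loss l n a b)"
    unfolding avg_loss_def[abs_def]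
    by (intro convex_on_cmul sum_convex_on piecewise_convex_quadratic_cmul
        piecewise_convex_quadratic_sum; simp)+
  show "0 \<le> avg_loss l n a b x"
    using assms by (simp add: avg_loss_def admissible_loss_def sum_nonneg)
qed

lemma avg_loss_multi_convex_pcq:
  fixes a :: "nat \<Rightarrow> real ^ 'd" and b :: "nat \<Rightarrow> 'm::finite \<Rightarrow> 'b"
  assumes "\<And>y. admissible_loss (\<lambda>z. l z y)"
  shows "convex_on UNIV (avg_loss_multi l n a b)"
    and "piecewise_convex_quadratic (avg_loss_multi l n a b)" and "0 \<le> avg_loss_multi l n a b x"
proof -
  have "convex_on UNIV (\<lambda>x :: real ^ 'd ^ 'm. l (x $ m \<bullet> a i) (b i m))"
    "piecewise_convex_quadratic (\<lambda>x :: real ^ 'd ^ 'm. l (x $ m \<bullet> a i) (b i m))" for i m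
    using assms[of "b i m"] convex_on_compose_inner[of "\<lambda>z. l z (b i m)" "axis m (a i)"]
      piecewise_convex_quadratic_compose_inner[of "\<lambda>z. l z (b i m)" "axis m (a i)"]
    by (simp_all add: admissible_loss_def inner_axis)
  then show "convex_on UNIV (avg_loss_multi l n a b)"
    "piecewise_convex_quadratic (avg_loss_multi l n a b)"
    unfolding avg_loss_multi_def[abs_def]
    by (intro convex_on_cmul sum_convex_on piecewise_convex_quadratic_cmul
        piecewise_convex_quadratic_sum; simp)+
  show "0 \<le> avg_loss_multi l n a b x"
    using assms by (simp add: avg_loss_multi_def admissible_loss_def sum_nonneg)
qed

lemma regularized_objective:
  fixes f R :: "'a::euclidean_space \<Rightarrow> real"
  assumes f: "convex_on UNIV f" "piecewise_convex_quadratic f" "\<And>x. 0 \<le> f x"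
    and R: "convex_on UNIV R" "piecewise_convex_quadratic R"
    and growth: "0 < \<alpha>" "\<And>x. \<alpha> * norm x \<le> R x + \<beta>" and lam: "0 < lam"
  shows "(\<forall>\<xi>>0. HEB (\<lambda>x. f x + lam * R x) (1/2) (sublevel (\<lambda>x. f x + lam * R x) \<xi>)) \<and>
    adaAGC_linear_convergence f (\<lambda>x. lam * R x)"
proof (intro conjI allI impI)
  fix \<xi> :: real assume "0 < \<xi>"
  have "lam * \<alpha> * norm x \<le> (f x + lam * R x) + lam * \<beta>" for x
    using mult_left_mono[OF growth(2)[of x], of lam] f(3)[of x] lam by (simp add: algebra_simps)
  moreover have "0 < lam * \<alpha>" using lam growth(1) by simp
  moreover have "piecewise_convex_quadratic (\<lambda>x. f x + lam * R x)"
    using lam by (intro piecewise_convex_quadratic_add piecewise_convex_quadratic_cmul f R) simp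
  ultimately show "HEB (\<lambda>x. f x + lam * R x) (1/2) (sublevel (\<lambda>x. f x + lam * R x) \<xi>)"
    using \<open>0 < \<xi>\<close> piecewise_convex_quadratic_HEB by blast
next
  show "adaAGC_linear_convergence f (\<lambda>x. lam * R x)"
    using lam R(1) f(1) by (intro adaAGC_linear_convergence_convex convex_on_cmul) auto
qed

theorem corollary3:
  fixes n :: nat and a :: "nat \<Rightarrow> real ^ 'd" and lam :: real
    and l :: "real \<Rightarrow> 'b \<Rightarrow> real" and b :: "nat \<Rightarrow> 'b" and bm :: "nat \<Rightarrow> 'm::finite \<Rightarrow> 'b"
    and R :: "real ^ 'd \<Rightarrow> real"
  assumes "n \<ge> 1" and "lam > 0"
    and "\<And>y. admissible_loss (\<lambda>z. l z y)"
    and "R = l1_norm \<or> R = infnorm \<or> (\<exists>\<delta>>0. R = huber_norm \<delta>)"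
  shows "(let f = avg_loss l n a b; g = (\<lambda>x. lam * R x); F = (\<lambda>x. f x + g x) in
            (\<forall>\<xi>>0. HEB F (1/2) (sublevel F \<xi>)) \<and> adaAGC_linear_convergence f g) \<and>
         (let f = avg_loss_multi l n a bm; g = (\<lambda>x. lam * l1_inf_norm x); F = (\<lambda>x. f x + g x) in
            (\<forall>\<xi>>0. HEB F (1/2) (sublevel F \<xi>)) \<and> adaAGC_linear_convergence f g)"
proof -
  have "\<exists>\<alpha> \<beta>. convex_on UNIV R \<and> piecewise_convex_quadratic R \<and> 0 < \<alpha> \<and> (\<forall>x. \<alpha> * norm x \<le> R x + \<beta>)"
    using assms(4)
  proof (elim disjE exE conjE)
    assume R: "R = l1_norm"
    have "convex_on UNIV R" "piecewise_convex_quadratic R"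
      unfolding R l1_norm_def[abs_def] by (intro separable_convex_pcq abs_convex_pcq)+
    moreover have "1 * norm x \<le> R x + 0" for x using norm_le_l1_cart[of x] by (simp add: R l1_norm_def)
    ultimately show ?thesis using zero_less_one by blast
  next
    assume R: "R = infnorm"
    have "1 / sqrt DIM(real ^ 'd) * norm x \<le> R x + 0" for x
      using norm_le_sqrt_DIM_infnorm[of x] by (simp add: R)
    moreover have "0 < 1 / sqrt DIM(real ^ 'd)" by simp
    ultimately show ?thesis using infnorm_convex_pcq unfolding R by blast
  next
    fix \<delta> :: real assume \<delta>: "0 < \<delta>" and R: "R = huber_norm \<delta>"
    have "convex_on UNIV R" "piecewise_convex_quadratic R"
      unfolding R huber_norm_def[abs_def] by (intro separable_convex_pcq huber_convex_pcq[OF \<delta>])+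
    then show ?thesis using norm_le_huber_norm[OF \<delta>] \<delta> unfolding R by blast
  qed
  then obtain \<alpha> \<beta> where R: "convex_on UNIV R" "piecewise_convex_quadratic R" "0 < \<alpha>"
    "\<And>x. \<alpha> * norm x \<le> R x + \<beta>" by blast
  have growth: "1 / sqrt DIM(real ^ 'd) * norm x \<le> l1_inf_norm x + 0" for x :: "real ^ 'd ^ 'm"
    using norm_le_l1_inf_norm[of x] by simp
  have pos: "0 < 1 / sqrt DIM(real ^ 'd)" by simp
  show ?thesis
    unfolding Let_def
    using regularized_objective[OF avg_loss_convex_pcq[where l = l and n = n and a = a and b = b,
          OF assms(3)] R assms(2)]
      regularized_objective[OF avg_loss_multi_convex_pcq[where l = l and n = n and a = a and b = bm,
          OF assms(3)] l1_inf_norm_convex_pcq pos growth assms(2)]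
    by (rule conjI)
qed

end
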